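(* Let $X$ and $Y$ be compact, zero-dimensional absolute extensors for $0$-dimensional spaces, of the same weight, such that every one-point subset of $X$ is negligible in $X$ and every one-point subset of $Y$ is negligible in $Y$. Let $P$ be a closed negligible subset of $X$ and $K$ a closed negligible subset of $Y$. If $f:P\to K$ is a (surjective) homeomorphism, then there exists a (surjective) homeomorphism $\widetilde f:X\to Y$ with $\widetilde f|_P=f$.
   Context: Compact spaces are assumed Hausdorff. The weight of a space is the least cardinality of a base of its topology. A subset of a topological space $Z$ is called negligible (in $Z$) if it does not contain a non-empty intersection of a family of open subsets of $Z$ such that the cardinality of the family is less than the weight of $Z$. A compact space $X$ is an absolute extensor for $0$-dimensional spaces if for every zero-dimensional compact (Hausdorff) space $Z$ and every closed subset $L\subset Z$, every continuous map $L\to X$ extends to a continuous map $Z\to X$. *)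

theory Defs
  imports "HOL-Analysis.Analysis"
begin

unbundle cardinal_syntax

definition is_base :: "'a topology \<Rightarrow> 'a set set \<Rightarrow> bool" where
  "is_base X \<B> \<longleftrightarrow>
     (\<forall>B\<in>\<B>. openin X B) \<and>
     (\<forall>U x. openin X U \<and> x \<in> U \<longrightarrow> (\<exists>B\<in>\<B>. x \<in> B \<and> B \<subseteq> U))"

definition zero_dimensional_space :: "'a topology \<Rightarrow> bool" where
  "zero_dimensional_space X \<longleftrightarrow> (\<exists>\<B>. is_base X \<B> \<and> (\<forall>B\<in>\<B>. closedin X B))"

text \<open>A cardinal is represented by a cardinal order, unique only up to the relation \<open>=o\<close>,
  so cardinals are to be compared with \<open>=o\<close>, \<open>\<le>o\<close> and \<open><o\<close>, never with equality.\<close>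

definition weight :: "'a topology \<Rightarrow> 'a set rel" where
  "weight X = (SOME r. \<exists>\<B>. is_base X \<B> \<and> r = |\<B>| \<and> (\<forall>\<C>. is_base X \<C> \<longrightarrow> |\<B>| \<le>o |\<C>| ))"

lemma weight_least:
  obtains \<B> where "is_base X \<B>" "weight X = |\<B>|" "\<And>\<C>. is_base X \<C> \<Longrightarrow> weight X \<le>o |\<C>|"
proof -
  let ?R = "card_of ` {\<B>. is_base X \<B>}"
  have "is_base X {U. openin X U}"
    by (auto simp: is_base_def)
  then have "?R \<noteq> {}" by blast
  moreover have "\<forall>r\<in>?R. Card_order r" by (auto simp: card_of_Card_order)
  ultimately obtain r where r: "r \<in> ?R" "\<forall>r'\<in>?R. r \<le>o r'"
    using exists_minim_Card_order by meson
  have "\<exists>r \<B>. is_base X \<B> \<and> r = |\<B>| \<and> (\<forall>\<C>. is_base X \<C> \<longrightarrow> |\<B>| \<le>o |\<C>| )"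
    using r by auto
  from someI_ex[OF this] show thesis
    using that unfolding weight_def by metis
qed

text \<open>Intersecting with the whole space gives the empty family its usual intersection.\<close>

definition negligible_in :: "'a topology \<Rightarrow> 'a set \<Rightarrow> bool" where
  "negligible_in Z A \<longleftrightarrow>
     \<not> (\<exists>\<U>. (\<forall>U\<in>\<U>. openin Z U) \<and> |\<U>| <o weight Z \<and>
          topspace Z \<inter> \<Inter>\<U> \<noteq> {} \<and> topspace Z \<inter> \<Inter>\<U> \<subseteq> A)"

text \<open>A definition cannot quantify over the types carrying the test spaces \<open>Z\<close>, so they are
  taken on the type \<open>'a set \<Rightarrow> bool\<close>. It carries the Cantor cube indexed by the clopen
  sets of \<open>X\<close>, in which a zero-dimensional compact \<open>X\<close> embeds; for such \<open>X\<close>, extension from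
  closed subsets of these spaces yields it for test spaces on every type: see
  \<open>absolute_extensor_0_any_type\<close> below.\<close>

definition absolute_extensor_0 :: "'a topology \<Rightarrow> bool" where
  "absolute_extensor_0 X \<longleftrightarrow>
     (\<forall>(Z :: ('a set \<Rightarrow> bool) topology) L f.
        compact_space Z \<and> Hausdorff_space Z \<and> zero_dimensional_space Z \<and> closedin Z L \<and>
        continuous_map (subtopology Z L) X f \<longrightarrow>
        (\<exists>g. continuous_map Z X g \<and> (\<forall>z\<in>L. g z = f z)))"

lemma clopen_extension:
  assumes Z: "compact_space Z" "zero_dimensional_space Z" and L: "closedin Z L"
    and A: "openin (subtopology Z L) A" "closedin (subtopology Z L) A"
  obtains W where "openin Z W" "closedin Z W" "W \<inter> L = A"
proof -
  obtain G where G: "openin Z G" "A = G \<inter> L"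
    using A(1) by (auto simp: openin_subtopology)
  obtain \<B> where \<B>: "is_base Z \<B>" "\<forall>B\<in>\<B>. closedin Z B"
    using Z(2) by (auto simp: zero_dimensional_space_def)
  have "closedin Z A" using A(2) L closedin_trans_full by blast
  then have "compactin Z A" using Z(1) closedin_compact_space by blast
  moreover have "\<forall>U\<in>{B\<in>\<B>. B \<subseteq> G}. openin Z U" using \<B>(1) by (auto simp: is_base_def)
  moreover have "A \<subseteq> \<Union>{B\<in>\<B>. B \<subseteq> G}"
    using \<B>(1) G unfolding is_base_def by blast
  ultimately obtain \<F> where \<F>: "finite \<F>" "\<F> \<subseteq> {B\<in>\<B>. B \<subseteq> G}" "A \<subseteq> \<Union>\<F>"
    unfolding compactin_def by meson
  show thesis
  proof
    show "openin Z (\<Union>\<F>)" using \<F>(2) \<B>(1) by (auto simp: is_base_def)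
    show "closedin Z (\<Union>\<F>)" using \<F>(1,2) \<B>(2) by (intro closedin_Union) auto
    show "\<Union>\<F> \<inter> L = A" using \<F>(2,3) G(2) by auto
  qed
qed

lemma continuous_map_clopen_indicator:
  assumes "openin Z W" "closedin Z W"
  shows "continuous_map Z (discrete_topology UNIV) (\<lambda>z. z \<in> W)"
proof -
  have "openin Z {z \<in> topspace Z. (z \<in> W) \<in> U}" for U :: "bool set"
  proof -
    have "openin Z (topspace Z - W)" "W \<subseteq> topspace Z"
      using assms by (auto simp: closedin_def)
    moreover have "{z \<in> topspace Z. (z \<in> W) \<in> U} =
        (if True \<in> U then W else {}) \<union> (if False \<in> U then topspace Z - W else {})"
      using \<open>W \<subseteq> topspace Z\<close> by (auto split: if_splits) (metis (full_types))+
    ultimately show ?thesis using assms(1) by auto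
  qed
  then show ?thesis by (auto simp: continuous_map_def)
qed

lemma zero_dimensional_cube:
  "zero_dimensional_space (product_topology (\<lambda>_. discrete_topology (UNIV :: bool set)) I)"
    (is "zero_dimensional_space ?T")
proof -
  let ?B = "{B. openin ?T B \<and> closedin ?T B}"
  have "\<exists>B\<in>?B. x \<in> B \<and> B \<subseteq> U" if U: "openin ?T U" "x \<in> U" for U x
  proof -
    obtain V where V: "finite {i \<in> I. V i \<noteq> UNIV}" "x \<in> Pi\<^sub>E I V" "Pi\<^sub>E I V \<subseteq> U"
      using U unfolding openin_product_topology_alt by (auto; metis)
    have "openin ?T (Pi\<^sub>E I V)" using V(1) by (subst openin_PiE_gen) auto
    moreover have "closedin ?T (Pi\<^sub>E I V)" by (simp add: closedin_product_topology)
    ultimately show ?thesis using V by blast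
  qed
  then show ?thesis
    unfolding zero_dimensional_space_def is_base_def by (intro exI[of _ ?B]) auto
qed

lemma absolute_extensor_0_any_type:
  fixes X :: "'a topology" and Z :: "'z topology"
  assumes X: "compact_space X" "Hausdorff_space X" "zero_dimensional_space X"
    and ext: "absolute_extensor_0 X"
    and Z: "compact_space Z" "Hausdorff_space Z" "zero_dimensional_space Z"
    and L: "closedin Z L" and f: "continuous_map (subtopology Z L) X f"
  shows "\<exists>g. continuous_map Z X g \<and> (\<forall>z\<in>L. g z = f z)"
proof -
  define C where "C = {U. openin X U \<and> closedin X U}"
  define T where "T = product_topology (\<lambda>_::'a set. discrete_topology (UNIV :: bool set)) C"
  define e where "e = (\<lambda>x. restrict (\<lambda>U. x \<in> U) C)"
  have T: "compact_space T" "Hausdorff_space T" "zero_dimensional_space T"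
    by (auto simp: T_def compact_space_product_topology Hausdorff_space_product_topology
        zero_dimensional_cube compact_space_discrete_topology)
  have cont_e: "continuous_map X T e"
    unfolding T_def e_def continuous_map_componentwise
    by (auto simp: C_def intro: continuous_map_clopen_indicator)
  have inj_e: "inj_on e (topspace X)"
  proof (rule inj_onI, rule ccontr)
    fix x y assume xy: "x \<in> topspace X" "y \<in> topspace X" "e x = e y" "x \<noteq> y"
    obtain U where U: "openin X U" "x \<in> U" "y \<notin> U"
      using X(2) xy by (auto simp: Hausdorff_space_def disjnt_iff) metis
    obtain B where "B \<in> C" "x \<in> B" "B \<subseteq> U"
      using X(3) U unfolding zero_dimensional_space_def is_base_def C_def by blast
    moreover have "e x B = e y B" using xy(3) by simp
    ultimately show False using U(3) by (auto simp: e_def)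
  qed
  have closed_e: "closed_map X T e"
    using continuous_imp_closed_map[OF cont_e X(1) T(2)] .
  then have "embedding_map X T e"
    using injective_closed_imp_embedding_map cont_e inj_e by blast
  then obtain k where k: "homeomorphic_maps X (subtopology T (e ` topspace X)) e k"
    by (auto simp: embedding_map_def homeomorphic_map_maps)
  have "closedin T (e ` topspace X)"
    using closed_e by (auto simp: closed_map_def)
  moreover have "continuous_map (subtopology T (e ` topspace X)) X k"
    using k by (simp add: homeomorphic_maps_def)
  ultimately obtain r where r: "continuous_map T X r" "\<forall>z\<in>e ` topspace X. r z = k z"
    using ext T unfolding absolute_extensor_0_def by blast
  have re: "r (e x) = x" if "x \<in> topspace X" for x
    using that r(2) k by (auto simp: homeomorphic_maps_def)
  have "\<exists>W. openin Z W \<and> closedin Z W \<and> W \<inter> L = {z \<in> L. f z \<in> U}" if "U \<in> C" for U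
  proof -
    have "topspace (subtopology Z L) = L" using L closedin_subset by fastforce
    then have "openin (subtopology Z L) {z \<in> L. f z \<in> U}" "closedin (subtopology Z L) {z \<in> L. f z \<in> U}"
      using that f openin_continuous_map_preimage closedin_continuous_map_preimage
      unfolding C_def by force+
    then show ?thesis using clopen_extension[OF Z(1,3) L] by metis
  qed
  then obtain W where W: "\<And>U. U \<in> C \<Longrightarrow> openin Z (W U) \<and> closedin Z (W U) \<and> W U \<inter> L = {z \<in> L. f z \<in> U}"
    by metis
  define g where "g = (\<lambda>z. restrict (\<lambda>U. z \<in> W U) C)"
  have "continuous_map Z T g"
    unfolding T_def g_def continuous_map_componentwise
    by (auto simp: W intro: continuous_map_clopen_indicator)
  then have "continuous_map Z X (r \<circ> g)" using r(1) continuous_map_compose by blast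
  moreover have "(r \<circ> g) z = f z" if "z \<in> L" for z
  proof -
    have "g z = e (f z)" using W that unfolding g_def e_def by (intro restrict_ext) blast
    moreover have "f z \<in> topspace X"
      using f that L closedin_subset by (fastforce simp: continuous_map_def)
    ultimately show ?thesis by (simp add: re)
  qed
  ultimately show ?thesis by blast
qed

end

theory Submission
  imports Defs
begin

text \<open>A back-and-forth argument on clopen sets. A retraction of a Cantor cube onto \<open>X\<close> assigns to
  every clopen set \<open>U\<close> a finite set \<open>F U\<close> of clopen sets (the coordinates on which its preimage
  depends), and for a family \<open>S\<close> closed under \<open>F\<close> the quotient of \<open>X\<close> by \<open>S\<close> is an open map. If \<open>S\<close> has
  fewer elements than the weight, its fibres are intersections of fewer than weight many open sets;
  negligibility of \<open>P\<close> and of points then gives every fibre two points outside \<open>P\<close>, and compactness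
  and openness give two disjoint clopen sets, both missing \<open>P\<close> and both meeting every fibre. This is
  what allows a partial isomorphism between clopen algebras that is compatible with \<open>f\<close> to be
  extended by one prescribed clopen set. Countably many such steps lead from one closed family to
  the next, and these are iterated along the weight; openness need not be maintained at limits, since
  a union of closed families is closed.\<close>

subsection \<open>Clopen sets and the quotients they induce\<close>

definition clopens :: "'a topology \<Rightarrow> 'a set set" where
  "clopens X = {U. openin X U \<and> closedin X U}"

text \<open>The classes of \<open>same S\<close> are the fibres of the map into the cube whose
  coordinates are the indicators of the members of \<open>S\<close>.\<close>

definition same :: "'a set set \<Rightarrow> 'a \<Rightarrow> 'a \<Rightarrow> bool" where
  "same S x y \<longleftrightarrow> (\<forall>U\<in>S. x \<in> U \<longleftrightarrow> y \<in> U)"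

definition saturation :: "'a topology \<Rightarrow> 'a set set \<Rightarrow> 'a set \<Rightarrow> 'a set" where
  "saturation X S c = {x \<in> topspace X. \<exists>y\<in>c. same S x y}"

text \<open>In terms of Stone duality: the subalgebra generated by \<open>S\<close> is relatively complete, or
  equivalently the quotient map identifying points not separated by \<open>S\<close> is open.\<close>

definition rel_complete :: "'a topology \<Rightarrow> 'a set set \<Rightarrow> bool" where
  "rel_complete X S \<longleftrightarrow> (\<forall>c\<in>clopens X. saturation X S c \<in> clopens X)"

lemma same_refl: "same S x x"
  by (simp add: same_def)

lemma same_sym: "same S x y \<Longrightarrow> same S y x"
  by (auto simp: same_def)

lemma same_trans: "same S x y \<Longrightarrow> same S y z \<Longrightarrow> same S x z"
  by (auto simp: same_def)

lemma clopens_subset: "U \<in> clopens X \<Longrightarrow> U \<subseteq> topspace X"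
  by (simp add: clopens_def openin_subset)

lemma clopens_Un: "U \<in> clopens X \<Longrightarrow> V \<in> clopens X \<Longrightarrow> U \<union> V \<in> clopens X"
  and clopens_Int: "U \<in> clopens X \<Longrightarrow> V \<in> clopens X \<Longrightarrow> U \<inter> V \<in> clopens X"
  and clopens_Diff: "U \<in> clopens X \<Longrightarrow> V \<in> clopens X \<Longrightarrow> U - V \<in> clopens X"
  and clopens_empty: "{} \<in> clopens X"
  and clopens_topspace: "topspace X \<in> clopens X"
  by (auto simp: clopens_def openin_diff closedin_diff)

lemma clopens_UN: "finite I \<Longrightarrow> (\<And>i. i \<in> I \<Longrightarrow> A i \<in> clopens X) \<Longrightarrow> (\<Union>i\<in>I. A i) \<in> clopens X"
  by (induction I rule: finite_induct) (auto intro: clopens_Un clopens_empty)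

lemma zero_dimensional_clopen:
  assumes "zero_dimensional_space X" "openin X U" "x \<in> U"
  obtains V where "V \<in> clopens X" "x \<in> V" "V \<subseteq> U"
proof -
  obtain \<B> where \<B>: "is_base X \<B>" "\<forall>B\<in>\<B>. closedin X B"
    using assms(1) by (auto simp: zero_dimensional_space_def)
  then obtain B where "B \<in> \<B>" "x \<in> B" "B \<subseteq> U"
    using assms(2,3) unfolding is_base_def by meson
  with \<B> show thesis using that[of B] by (auto simp: clopens_def is_base_def)
qed

lemma separating_clopen:
  assumes "zero_dimensional_space X" "Hausdorff_space X" "x \<in> topspace X" "y \<in> topspace X" "x \<noteq> y"
  obtains V where "V \<in> clopens X" "x \<in> V" "y \<notin> V"
proof -
  obtain U where "openin X U" "x \<in> U" "y \<notin> U"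
    using assms(2-) unfolding Hausdorff_space_def disjnt_iff by metis
  then show thesis
    using zero_dimensional_clopen[OF assms(1)] that by (metis subsetD)
qed

text \<open>\<open>Q\<close> is a finite union of atoms of the finite algebra generated by
  \<open>G\<close>.\<close>

lemma clopens_of_finitely_determined:
  assumes "finite G" "G \<subseteq> clopens X" "Q \<subseteq> topspace X"
    and det: "\<And>x y. x \<in> Q \<Longrightarrow> y \<in> topspace X \<Longrightarrow> same G x y \<Longrightarrow> y \<in> Q"
  shows "Q \<in> clopens X"
proof -
  \<comment> \<open>\<open>H\<close> selects the members of \<open>G\<close> that contain the point,
    so \<open>A G H\<close> is an atom or empty.\<close>
  define A where "A = (\<lambda>G H. {y \<in> topspace X. \<forall>U\<in>G. U \<in> H \<longleftrightarrow> y \<in> U})"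
  have A: "A G H \<in> clopens X" for H
    using assms(1,2)
  proof (induction G rule: finite_induct)
    case empty
    show ?case by (simp add: A_def clopens_topspace)
  next
    case (insert U G)
    have "A (insert U G) H = A G H \<inter> (if U \<in> H then U else topspace X - U)"
      by (auto simp: A_def)
    then show ?case
      using insert by (auto intro: clopens_Int clopens_Diff clopens_topspace)
  qed
  have "finite ((\<lambda>x. {U \<in> G. x \<in> U}) ` Q)"
    by (rule finite_subset[of _ "Pow G"]) (use assms(1) in auto)
  then have "(\<Union>H\<in>(\<lambda>x. {U \<in> G. x \<in> U}) ` Q. A G H) \<in> clopens X"
    using A by (rule clopens_UN)
  moreover have "(\<Union>H\<in>(\<lambda>x. {U \<in> G. x \<in> U}) ` Q. A G H) = Q"
    using assms(3) det by (auto simp: A_def same_def)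
  ultimately show ?thesis by simp
qed

subsection \<open>Finite supports from a retraction of a Cantor cube\<close>

text \<open>By compactness \<open>V\<close> is a finite union of basic boxes, each restricting
  finitely many coordinates; \<open>F\<close> collects the restricted ones.\<close>

lemma clopen_cube_support:
  assumes "V \<in> clopens (product_topology (\<lambda>_. discrete_topology (UNIV :: bool set)) I)"
    (is "_ \<in> clopens ?T")
  obtains F where "finite F" "F \<subseteq> I"
    "\<And>z z'. z \<in> V \<Longrightarrow> z' \<in> topspace ?T \<Longrightarrow> (\<And>i. i \<in> F \<Longrightarrow> z i = z' i) \<Longrightarrow> z' \<in> V"
proof -
  have V: "openin ?T V" "closedin ?T V" using assms by (auto simp: clopens_def)
  define \<U> where "\<U> = {Pi\<^sub>E I W | W. finite {i \<in> I. W i \<noteq> UNIV} \<and> Pi\<^sub>E I W \<subseteq> V}"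
  have "compact_space ?T"
    by (auto simp: compact_space_product_topology compact_space_discrete_topology)
  then have "compactin ?T V" using V(2) closedin_compact_space by blast
  moreover have "\<forall>U\<in>\<U>. openin ?T U"
    unfolding \<U>_def by (auto simp: openin_PiE_gen)
  moreover have "V \<subseteq> \<Union>\<U>"
  proof
    fix z assume "z \<in> V"
    then obtain W where "finite {i \<in> I. W i \<noteq> UNIV}" "z \<in> Pi\<^sub>E I W" "Pi\<^sub>E I W \<subseteq> V"
      using V(1) unfolding openin_product_topology_alt by (auto; metis)
    then show "z \<in> \<Union>\<U>" by (auto simp: \<U>_def)
  qed
  ultimately obtain \<F> where \<F>: "finite \<F>" "\<F> \<subseteq> \<U>" "V \<subseteq> \<Union>\<F>"
    unfolding compactin_def by meson
  have "\<forall>B\<in>\<F>. \<exists>W. B = Pi\<^sub>E I W \<and> finite {i \<in> I. W i \<noteq> UNIV} \<and> Pi\<^sub>E I W \<subseteq> V"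
    using \<F>(2) by (auto simp: \<U>_def)
  then obtain w where w: "\<And>B. B \<in> \<F> \<Longrightarrow> B = Pi\<^sub>E I (w B) \<and> finite {i \<in> I. w B i \<noteq> UNIV} \<and> Pi\<^sub>E I (w B) \<subseteq> V"
    by metis
  show thesis
  proof
    show "finite (\<Union>B\<in>\<F>. {i \<in> I. w B i \<noteq> UNIV})" using \<F>(1) w by blast
    show "(\<Union>B\<in>\<F>. {i \<in> I. w B i \<noteq> UNIV}) \<subseteq> I" by auto
    fix z z' assume z: "z \<in> V" "z' \<in> topspace ?T"
      and eq: "\<And>i. i \<in> (\<Union>B\<in>\<F>. {i \<in> I. w B i \<noteq> UNIV}) \<Longrightarrow> z i = z' i"
    obtain B where B: "B \<in> \<F>" "z \<in> B" using z(1) \<F>(3) by auto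
    then have "z \<in> Pi\<^sub>E I (w B)" using w by metis
    moreover have "z' i \<in> w B i" if "i \<in> I" for i
    proof (cases "w B i = UNIV")
      case False
      then have "z i = z' i" using that B(1) by (intro eq) auto
      moreover have "z i \<in> w B i" using PiE_mem[OF \<open>z \<in> Pi\<^sub>E I (w B)\<close> that] .
      ultimately show ?thesis by simp
    qed simp
    moreover have "z' \<in> extensional I" using z(2) by (auto simp: PiE_def)
    ultimately have "z' \<in> Pi\<^sub>E I (w B)" by (auto simp: PiE_def)
    then show "z' \<in> V" using w B(1) by blast
  qed
qed

text \<open>The rest of the proof uses the extensor property only through such an \<open>F\<close>.
  Being closed under \<open>F\<close> is inherited by unions, which takes care of relative
  completeness at limit stages.\<close>

definition supporting :: "'a topology \<Rightarrow> ('a set \<Rightarrow> 'a set set) \<Rightarrow> bool" where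
  "supporting X F \<longleftrightarrow> (\<forall>U\<in>clopens X. finite (F U) \<and> F U \<subseteq> clopens X) \<and>
     (\<forall>S. S \<subseteq> clopens X \<longrightarrow> (\<forall>U\<in>S. F U \<subseteq> S) \<longrightarrow> rel_complete X S)"

text \<open>Embed \<open>X\<close> by \<open>e\<close> in the Cantor cube over its clopen sets and
  extend the inverse to a map \<open>r\<close> on the cube; \<open>F U\<close> is a finite set of
  coordinates deciding whether \<open>r z\<close> lies in \<open>U\<close>. If \<open>S\<close> is
  closed under \<open>F\<close>, saturating by \<open>S\<close> amounts to forgetting the
  coordinates outside \<open>S\<close>, and such projections take clopen sets to clopen
  sets.\<close>

lemma absolute_extensor_0_supporting:
  fixes X :: "'a topology"
  assumes X: "compact_space X" "Hausdorff_space X" "zero_dimensional_space X"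
    and ext: "absolute_extensor_0 X"
  shows "\<exists>F. supporting X F"
proof -
  define C where "C = clopens X"
  define T where "T = product_topology (\<lambda>_::'a set. discrete_topology (UNIV :: bool set)) C"
  define e where "e = (\<lambda>x. restrict (\<lambda>U. x \<in> U) C)"
  have T: "compact_space T" "Hausdorff_space T" "zero_dimensional_space T"
    by (auto simp: T_def compact_space_product_topology Hausdorff_space_product_topology
        zero_dimensional_cube compact_space_discrete_topology)
  have cont_e: "continuous_map X T e"
    unfolding T_def e_def continuous_map_componentwise
    by (auto simp: C_def clopens_def intro: continuous_map_clopen_indicator)
  have inj_e: "inj_on e (topspace X)"
  proof (rule inj_onI, rule ccontr)
    fix x y assume xy: "x \<in> topspace X" "y \<in> topspace X" "e x = e y" "x \<noteq> y"
    obtain B where B: "B \<in> C" "x \<in> B" "y \<notin> B"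
      using separating_clopen[OF X(3,2) xy(1,2,4)] unfolding C_def by metis
    moreover have "e x B = e y B" using xy(3) by simp
    ultimately show False by (auto simp: e_def)
  qed
  obtain k where k: "homeomorphic_maps X (subtopology T (e ` topspace X)) e k"
    using continuous_imp_embedding_map[OF cont_e X(1) T(2) inj_e]
    by (auto simp: embedding_map_def homeomorphic_map_maps)
  have "closedin T (e ` topspace X)"
    using continuous_imp_closed_map[OF cont_e X(1) T(2)] by (auto simp: closed_map_def)
  moreover have "continuous_map (subtopology T (e ` topspace X)) X k"
    using k by (simp add: homeomorphic_maps_def)
  ultimately obtain r where r: "continuous_map T X r" "\<forall>z\<in>e ` topspace X. r z = k z"
    using ext T unfolding absolute_extensor_0_def by blast
  have re: "r (e x) = x" if "x \<in> topspace X" for x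
    using that r(2) k by (auto simp: homeomorphic_maps_def)
  have e_T: "e x \<in> topspace T" if "x \<in> topspace X" for x
    using that cont_e by (auto simp: continuous_map_def)
  have "\<exists>F. finite F \<and> F \<subseteq> C \<and> (\<forall>z\<in>topspace T. \<forall>z'\<in>topspace T.
      (\<forall>i\<in>F. z i = z' i) \<longrightarrow> r z \<in> U \<longrightarrow> r z' \<in> U)" if "U \<in> C" for U
  proof -
    have "{z \<in> topspace T. r z \<in> U} \<in> clopens T"
      using that r(1) openin_continuous_map_preimage closedin_continuous_map_preimage
      unfolding C_def clopens_def by blast
    then obtain F where F: "finite F" "F \<subseteq> C" "\<And>z z'. z \<in> {z \<in> topspace T. r z \<in> U} \<Longrightarrow>
        z' \<in> topspace T \<Longrightarrow> (\<And>i. i \<in> F \<Longrightarrow> z i = z' i) \<Longrightarrow> z' \<in> {z \<in> topspace T. r z \<in> U}"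
      unfolding T_def using clopen_cube_support by blast
    have "r z' \<in> U" if "z \<in> topspace T" "z' \<in> topspace T" "\<forall>i\<in>F. z i = z' i" "r z \<in> U" for z z'
      using F(3)[of z z'] that by simp
    with F(1,2) show ?thesis by blast
  qed
  then obtain F where F: "\<And>U. U \<in> C \<Longrightarrow> finite (F U) \<and> F U \<subseteq> C"
    and supp: "\<And>U z z'. U \<in> C \<Longrightarrow> z \<in> topspace T \<Longrightarrow> z' \<in> topspace T \<Longrightarrow> (\<forall>i\<in>F U. z i = z' i)
      \<Longrightarrow> r z \<in> U \<Longrightarrow> r z' \<in> U"
    by metis
  have "rel_complete X S" if S: "S \<subseteq> C" "\<And>U. U \<in> S \<Longrightarrow> F U \<subseteq> S" for S
    unfolding rel_complete_def
  proof
    fix c assume c: "c \<in> clopens X"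
    \<comment> \<open>\<open>Q x\<close> says that the \<open>S\<close>-coordinates of
      \<open>x\<close> can be completed to a point of the cube that \<open>r\<close> sends into
      \<open>c\<close>.\<close>
    define Q where "Q = (\<lambda>x. \<exists>z\<in>topspace T. (\<forall>U\<in>S. z U \<longleftrightarrow> x \<in> U) \<and> r z \<in> c)"
    have sat: "saturation X S c = {x \<in> topspace X. Q x}"
    proof (intro set_eqI iffI)
      fix x assume "x \<in> saturation X S c"
      then obtain y where y: "x \<in> topspace X" "y \<in> c" "same S x y"
        by (auto simp: saturation_def)
      then have "y \<in> topspace X" using c clopens_subset by blast
      then have "r (e y) \<in> c" "e y \<in> topspace T" using y(2) by (simp_all add: re e_T)
      moreover have "\<forall>U\<in>S. e y U \<longleftrightarrow> x \<in> U"
        using y(3) S(1) by (auto simp: e_def same_def)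
      ultimately have "Q x" unfolding Q_def by blast
      with y(1) show "x \<in> {x \<in> topspace X. Q x}" by simp
    next
      fix x assume "x \<in> {x \<in> topspace X. Q x}"
      then obtain z where x: "x \<in> topspace X" and z: "z \<in> topspace T" "\<And>U. U \<in> S \<Longrightarrow> z U \<longleftrightarrow> x \<in> U" "r z \<in> c"
        by (auto simp: Q_def)
      \<comment> \<open>Membership of \<open>r z\<close> in \<open>U\<close> is decided by the
        coordinates in \<open>F U\<close>, a subset of \<open>S\<close>, and there \<open>z\<close>
        agrees with \<open>e x\<close>.\<close>
      have "x \<in> U \<longleftrightarrow> r z \<in> U" if U: "U \<in> S" for U
      proof -
        have agree: "\<forall>i\<in>F U. z i = e x i"
          using S U z(2) by (auto simp: e_def)
        have "r z \<in> U \<longleftrightarrow> r (e x) \<in> U"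
          using supp[OF _ z(1) e_T[OF x], of U] supp[OF _ e_T[OF x] z(1), of U] agree U S(1) by auto
        then show ?thesis using re x by simp
      qed
      then show "x \<in> saturation X S c" using x z(3) by (auto simp: saturation_def same_def)
    qed
    have "Q y" if "Q x" "y \<in> topspace X" "same (F c \<inter> S) x y" for x y
    proof -
      obtain z where z: "z \<in> topspace T" "\<And>U. U \<in> S \<Longrightarrow> z U \<longleftrightarrow> x \<in> U" "r z \<in> c"
        using \<open>Q x\<close> by (auto simp: Q_def)
      \<comment> \<open>\<open>z'\<close> takes its coordinates in \<open>S\<close> from
        \<open>y\<close> and the others from \<open>z\<close>. It agrees with \<open>z\<close> on
        \<open>F c\<close>, since \<open>x\<close> and \<open>y\<close> are not separated by the
        part of \<open>F c\<close> in \<open>S\<close>.\<close>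
      define z' where "z' = restrict (\<lambda>U. if U \<in> S then y \<in> U else z U) C"
      have z': "z' \<in> topspace T" by (simp add: z'_def T_def)
      have "z i = z' i" if "i \<in> F c" for i
        using F[of c] c that z(2) \<open>same (F c \<inter> S) x y\<close> by (auto simp: z'_def same_def C_def)
      then have "r z' \<in> c"
        using supp[OF _ z(1) z' _ z(3)] c by (auto simp: C_def)
      then show ?thesis
        unfolding Q_def using z' S(1) by (intro bexI[of _ z']) (auto simp: z'_def)
    qed
    then show "saturation X S c \<in> clopens X"
      unfolding sat using F[of c] c by (intro clopens_of_finitely_determined[of "F c \<inter> S"]) (auto simp: C_def)
  qed
  then have "supporting X F"
    using F unfolding supporting_def C_def by simp
  then show ?thesis by blast
qed

subsection \<open>Clopen sets meeting every fibre\<close>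

text \<open>A new member \<open>U\<close> cuts every fibre of \<open>S\<close> in two, so the two
  halves of \<open>c\<close> can be saturated separately.\<close>

lemma rel_complete_insert:
  assumes S: "rel_complete X S" and U: "U \<in> clopens X"
  shows "rel_complete X (insert U S)"
  unfolding rel_complete_def
proof
  fix c assume c: "c \<in> clopens X"
  have "saturation X (insert U S) c
      = (U \<inter> saturation X S (c \<inter> U)) \<union> (saturation X S (c - U) - U)"
    by (auto simp: saturation_def same_def)
  moreover have "saturation X S (c \<inter> U) \<in> clopens X" "saturation X S (c - U) \<in> clopens X"
    using S c U by (auto simp: rel_complete_def clopens_Int clopens_Diff)
  ultimately show "saturation X (insert U S) c \<in> clopens X"
    using U by (auto intro: clopens_Un clopens_Int clopens_Diff)
qed

lemma finite_ordLess_Cinfinite: "finite A \<Longrightarrow> Cinfinite r \<Longrightarrow> |A| <o r"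
  by (rule Cfinite_ordLess_Cinfinite) (simp_all add: cfinite_def card_of_card_order_on Field_card_of)

text \<open>Members of \<open>S\<close> and their complements are open, so the part of the fibre of
  \<open>x\<close> in \<open>V\<close> is a non-empty intersection of fewer than weight many open
  sets. Taking \<open>{x}\<close> for \<open>A\<close> yields a second point of the fibre.\<close>

lemma negligible_fibre:
  assumes S: "S \<subseteq> clopens X" "|S| <o weight X" and inf: "Cinfinite (weight X)"
    and A: "negligible_in X A" and V: "openin X V" "x \<in> V"
  obtains y where "y \<in> V" "same S x y" "y \<notin> A"
proof -
  define \<U> where "\<U> = insert V ((\<lambda>U. if x \<in> U then U else topspace X - U) ` S)"
  have x: "x \<in> topspace X" using V openin_subset by blast
  have "|{V}| <o weight X"
    using inf by (simp add: finite_ordLess_Cinfinite)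
  moreover have "|(\<lambda>U. if x \<in> U then U else topspace X - U) ` S| <o weight X"
    using card_of_image S(2) ordLeq_ordLess_trans by blast
  ultimately have "|\<U>| <o weight X"
    unfolding \<U>_def using Un_Cinfinite_bound_strict[OF _ _ inf] by fastforce
  moreover have "\<forall>U\<in>\<U>. openin X U"
    using V(1) S(1) by (auto simp: \<U>_def clopens_def)
  moreover have "x \<in> topspace X \<inter> \<Inter>\<U>" using x V(2) by (auto simp: \<U>_def)
  ultimately have "\<not> topspace X \<inter> \<Inter>\<U> \<subseteq> A"
    using A unfolding negligible_in_def by blast
  then obtain y where y: "y \<in> topspace X" "y \<in> \<Inter>\<U>" "y \<notin> A" by blast
  then have "same S x y" by (auto simp: \<U>_def same_def split: if_splits)
  with y show thesis using that by (auto simp: \<U>_def)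
qed

text \<open>Every fibre has two points outside \<open>P\<close>; disjoint clopen neighbourhoods of
  these, saturated by relative completeness, solve the problem over a saturated clopen set
  containing the fibre. By compactness finitely many such sets suffice, and the local solutions are
  patched.\<close>

lemma disjoint_transversal_clopens:
  assumes X: "compact_space X" "Hausdorff_space X" "zero_dimensional_space X"
    and inf: "Cinfinite (weight X)"
    and pts: "\<forall>x\<in>topspace X. negligible_in X {x}"
    and P: "closedin X P" "negligible_in X P"
    and S: "S \<subseteq> clopens X" "|S| <o weight X" "rel_complete X S"
  obtains C D where "C \<in> clopens X" "D \<in> clopens X" "C \<inter> D = {}" "C \<inter> P = {}" "D \<inter> P = {}"
    "\<forall>x\<in>topspace X. (\<exists>y\<in>C. same S x y) \<and> (\<exists>y\<in>D. same S x y)"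
proof -
  \<comment> \<open>\<open>Q Z\<close> is the conclusion restricted to \<open>Z\<close>; the members
    of \<open>\<W>\<close> are moreover clopen and saturated.\<close>
  define Q where "Q = (\<lambda>Z. Z \<subseteq> topspace X \<and> (\<exists>C\<in>clopens X. \<exists>D\<in>clopens X. C \<inter> D = {} \<and> C \<inter> P = {} \<and> D \<inter> P = {} \<and>
    C \<subseteq> Z \<and> D \<subseteq> Z \<and> (\<forall>x\<in>Z. (\<exists>y\<in>C. same S x y) \<and> (\<exists>y\<in>D. same S x y))))"
  define \<W> where "\<W> = {W \<in> clopens X. Q W \<and> (\<forall>x\<in>W. \<forall>y\<in>topspace X. same S x y \<longrightarrow> y \<in> W)}"
  have "\<exists>W\<in>\<W>. x \<in> W" if x: "x \<in> topspace X" for x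
  proof -
    obtain y0 where y0: "y0 \<in> topspace X" "same S x y0" "y0 \<notin> P"
      using negligible_fibre[OF S(1,2) inf P(2) openin_topspace x] .
    obtain V where V: "V \<in> clopens X" "y0 \<in> V" "V \<subseteq> topspace X - P"
      using zero_dimensional_clopen[OF X(3), of "topspace X - P" y0] y0 P(1) by blast
    obtain y1 where y1: "y1 \<in> V" "same S y0 y1" "y1 \<noteq> y0"
      using negligible_fibre[OF S(1,2) inf _ _ V(2), of "{y0}"] pts y0(1) V(1)
      by (auto simp: clopens_def)
    have "y1 \<in> topspace X" using y1(1) V(3) by blast
    then obtain E where E: "E \<in> clopens X" "y0 \<in> E" "y1 \<notin> E"
      using separating_clopen[OF X(3,2) y0(1)] y1(3) by metis
    \<comment> \<open>\<open>W\<close> consists of the points whose fibre meets both pieces of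
      \<open>V\<close>; the traces of these pieces on \<open>W\<close> serve as \<open>C\<close> and
      \<open>D\<close> there.\<close>
    define W where "W = saturation X S (V \<inter> E) \<inter> saturation X S (V - E)"
    have W: "W \<in> clopens X"
      unfolding W_def using S(3) V(1) E(1) by (auto simp: rel_complete_def clopens_Int clopens_Diff)
    have sat: "\<forall>x\<in>W. \<forall>y\<in>topspace X. same S x y \<longrightarrow> y \<in> W"
      unfolding W_def saturation_def using same_sym same_trans by fast
    have "\<exists>y\<in>V \<inter> E \<inter> W. same S z y" "\<exists>y\<in>(V - E) \<inter> W. same S z y" if z: "z \<in> W" for z
    proof -
      have "\<exists>y\<in>V \<inter> E. same S z y" "\<exists>y\<in>V - E. same S z y"
        using z by (auto simp: W_def saturation_def)
      then show "\<exists>y\<in>V \<inter> E \<inter> W. same S z y" "\<exists>y\<in>(V - E) \<inter> W. same S z y"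
        using sat z V(3) by blast+
    qed
    moreover have "V \<inter> E \<inter> W \<in> clopens X" "(V - E) \<inter> W \<in> clopens X"
      using V(1) E(1) W by (auto intro: clopens_Int clopens_Diff)
    moreover have "V \<inter> E \<inter> W \<inter> ((V - E) \<inter> W) = {}" "V \<inter> E \<inter> W \<inter> P = {}" "(V - E) \<inter> W \<inter> P = {}"
      "V \<inter> E \<inter> W \<subseteq> W" "(V - E) \<inter> W \<subseteq> W" "W \<subseteq> topspace X"
      using V(3) clopens_subset[OF W] by auto
    ultimately have "Q W" unfolding Q_def by meson
    moreover have "x \<in> W"
      using x y0(2) y1 V(2) E same_trans unfolding W_def saturation_def by fast
    ultimately show ?thesis using W sat by (auto simp: \<W>_def)
  qed
  then have "topspace X \<subseteq> \<Union>\<W>" by blast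
  moreover have "\<forall>W\<in>\<W>. openin X W" by (auto simp: \<W>_def clopens_def)
  ultimately obtain \<F> where \<F>: "finite \<F>" "\<F> \<subseteq> \<W>" "topspace X \<subseteq> \<Union>\<F>"
    using X(1) unfolding compact_space_alt by meson
  \<comment> \<open>The solution over \<open>W\<close> is kept, and that over \<open>Z\<close> is
    used only outside \<open>W\<close>. As \<open>W\<close> is saturated, fibres of points outside
    \<open>W\<close> miss it, so removing \<open>W\<close> from \<open>C\<close> and
    \<open>D\<close> changes nothing on them.\<close>
  have Un: "Q (W \<union> Z)" if W: "W \<in> \<W>" and Z: "Q Z" for W Z
  proof -
    have "Z \<subseteq> topspace X" using Z by (simp add: Q_def)
    obtain C D where CD: "C \<in> clopens X" "D \<in> clopens X" "C \<inter> D = {}" "C \<inter> P = {}" "D \<inter> P = {}"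
      "C \<subseteq> Z" "D \<subseteq> Z" "\<And>x. x \<in> Z \<Longrightarrow> (\<exists>y\<in>C. same S x y) \<and> (\<exists>y\<in>D. same S x y)"
      using Z unfolding Q_def by metis
    have "Q W" using W by (simp add: \<W>_def)
    then obtain C' D' where CD': "C' \<in> clopens X" "D' \<in> clopens X" "C' \<inter> D' = {}" "C' \<inter> P = {}" "D' \<inter> P = {}"
      "C' \<subseteq> W" "D' \<subseteq> W" "\<And>x. x \<in> W \<Longrightarrow> (\<exists>y\<in>C'. same S x y) \<and> (\<exists>y\<in>D'. same S x y)"
      unfolding Q_def by metis
    have W': "W \<in> clopens X" "\<And>x y. x \<in> W \<Longrightarrow> y \<in> topspace X \<Longrightarrow> same S x y \<Longrightarrow> y \<in> W"
      using W by (auto simp: \<W>_def)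
    have "(\<exists>y\<in>C' \<union> (C - W). same S x y) \<and> (\<exists>y\<in>D' \<union> (D - W). same S x y)" if x: "x \<in> W \<union> Z" for x
    proof (cases "x \<in> W")
      case True
      then show ?thesis using CD'(8) by blast
    next
      case False
      then obtain y y' where y: "y \<in> C" "y' \<in> D" "same S x y" "same S x y'" using x CD(8) by blast
      have "C \<subseteq> topspace X" "D \<subseteq> topspace X" using CD(1,2) clopens_subset by blast+
      moreover have "x \<in> topspace X" using x False \<open>Z \<subseteq> topspace X\<close> by blast
      ultimately have "y \<notin> W" "y' \<notin> W" using y False W'(2) same_sym by metis+
      then show ?thesis using y by blast
    qed
    moreover have "C' \<union> (C - W) \<in> clopens X" "D' \<union> (D - W) \<in> clopens X"
      using CD(1,2) CD'(1,2) W'(1) by (auto intro: clopens_Un clopens_Diff)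
    moreover have "(C' \<union> (C - W)) \<inter> (D' \<union> (D - W)) = {}" "(C' \<union> (C - W)) \<inter> P = {}"
      "(D' \<union> (D - W)) \<inter> P = {}" "C' \<union> (C - W) \<subseteq> W \<union> Z" "D' \<union> (D - W) \<subseteq> W \<union> Z"
      "W \<union> Z \<subseteq> topspace X"
      using CD(3-7) CD'(3-7) clopens_subset[OF W'(1)] \<open>Z \<subseteq> topspace X\<close> by auto
    ultimately show ?thesis unfolding Q_def by meson
  qed
  have "Q (\<Union>\<F>)" using \<F>(1,2)
  proof (induction \<F> rule: finite_induct)
    case empty
    show ?case unfolding Q_def using clopens_empty by fastforce
  next
    case (insert W \<F>)
    then show ?case using Un by simp
  qed
  then obtain C D where CD: "C \<in> clopens X" "D \<in> clopens X" "C \<inter> D = {}" "C \<inter> P = {}" "D \<inter> P = {}"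
      "\<And>x. x \<in> \<Union>\<F> \<Longrightarrow> (\<exists>y\<in>C. same S x y) \<and> (\<exists>y\<in>D. same S x y)"
    unfolding Q_def by metis
  show thesis
    by (rule that[OF CD(1-5)]) (use CD(6) \<F>(3) in blast)
qed

subsection \<open>Partial isomorphisms between clopen algebras\<close>

text \<open>For a partial isomorphism \<open>R\<close>, the matching pairs of points form the fibre
  product of \<open>X\<close> and \<open>Y\<close> over their common quotient.\<close>

definition matches :: "('a set \<times> 'b set) set \<Rightarrow> 'a \<Rightarrow> 'b \<Rightarrow> bool" where
  "matches R x y \<longleftrightarrow> (\<forall>(a, b)\<in>R. x \<in> a \<longleftrightarrow> y \<in> b)"

definition covers :: "'a topology \<Rightarrow> 'b topology \<Rightarrow> ('a set \<times> 'b set) set \<Rightarrow> bool" where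
  "covers X Y R \<longleftrightarrow> (\<forall>x\<in>topspace X. \<exists>y\<in>topspace Y. matches R x y)"

text \<open>By compactness, the two \<open>covers\<close> conditions say that \<open>R\<close> extends to an isomorphism between the
  Boolean algebras generated by its domain and its range.\<close>

definition partial_iso ::
  "'a topology \<Rightarrow> 'b topology \<Rightarrow> 'a set \<Rightarrow> ('a \<Rightarrow> 'b) \<Rightarrow> ('a set \<times> 'b set) set \<Rightarrow> bool" where
  "partial_iso X Y P f R \<longleftrightarrow> R \<subseteq> clopens X \<times> clopens Y \<and> covers X Y R \<and> covers Y X (R\<inverse>) \<and>
     (\<forall>x\<in>P. matches R x (f x))"

lemma matches_mono: "matches R x y \<Longrightarrow> R' \<subseteq> R \<Longrightarrow> matches R' x y"
  by (auto simp: matches_def)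

lemma matches_converse: "matches (R\<inverse>) y x \<longleftrightarrow> matches R x y"
  by (auto simp: matches_def)

lemma matches_insert: "matches (insert (a, b) R) x y \<longleftrightarrow> (x \<in> a \<longleftrightarrow> y \<in> b) \<and> matches R x y"
  by (auto simp: matches_def)

lemma matches_same_Domain: "matches R x y \<Longrightarrow> same (Domain R) x x' \<Longrightarrow> matches R x' y"
  by (fastforce simp: matches_def same_def)

lemma matches_same_Range: "matches R x y \<Longrightarrow> same (Range R) y y' \<Longrightarrow> matches R x y'"
  by (fastforce simp: matches_def same_def)

lemma same_Domain_if_matches: "matches R x y \<Longrightarrow> matches R x' y \<Longrightarrow> same (Domain R) x x'"
  by (fastforce simp: matches_def same_def)

lemma covers_mono: "covers X Y R \<Longrightarrow> R' \<subseteq> R \<Longrightarrow> covers X Y R'"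
  unfolding covers_def using matches_mono by meson

text \<open>For fixed \<open>x\<close>, each pair in \<open>R\<close> confines \<open>y\<close> to a
  closed set; the finite subrelations give the finite intersection property.\<close>

lemma covers_finite_character:
  assumes Y: "compact_space Y" and R: "R \<subseteq> clopens X \<times> clopens Y"
    and fin: "\<And>R'. finite R' \<Longrightarrow> R' \<subseteq> R \<Longrightarrow> covers X Y R'"
  shows "covers X Y R"
  unfolding covers_def
proof
  fix x assume x: "x \<in> topspace X"
  define \<phi> where "\<phi> = (\<lambda>(a, b). {y \<in> topspace Y. x \<in> a \<longleftrightarrow> y \<in> b})"
  have "closedin Y (\<phi> p)" if "p \<in> R" for p
  proof -
    obtain a b where p: "p = (a, b)" "b \<in> clopens Y" using R \<open>p \<in> R\<close> by (cases p) auto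
    have "\<phi> p = (if x \<in> a then b else topspace Y - b)"
      using clopens_subset[OF p(2)] by (auto simp: \<phi>_def p(1))
    then show ?thesis using p(2) by (auto simp: clopens_def)
  qed
  \<comment> \<open>\<open>topspace Y\<close> is inserted so that the intersection lies in
    \<open>Y\<close> even for empty \<open>R\<close>.\<close>
  then have "\<forall>C\<in>insert (topspace Y) (\<phi> ` R). closedin Y C" by auto
  moreover have "\<Inter>\<F> \<noteq> {}" if \<F>: "finite \<F>" "\<F> \<subseteq> insert (topspace Y) (\<phi> ` R)" for \<F>
  proof -
    have "finite (\<F> - {topspace Y})" "\<F> - {topspace Y} \<subseteq> \<phi> ` R" using \<F> by auto
    then obtain R' where R': "R' \<subseteq> R" "finite R'" "\<F> - {topspace Y} = \<phi> ` R'"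
      by (meson finite_subset_image)
    obtain y where "y \<in> topspace Y" "matches R' x y"
      using fin[OF R'(2,1)] x by (auto simp: covers_def)
    then have y: "y \<in> \<phi> p" if "p \<in> R'" for p
      using that by (auto simp: \<phi>_def matches_def)
    have "y \<in> C" if "C \<in> \<F>" for C
    proof (cases "C = topspace Y")
      case False
      then have "C \<in> \<phi> ` R'" using that R'(3) by blast
      then show ?thesis using y by blast
    qed (use \<open>y \<in> topspace Y\<close> in simp)
    then have "y \<in> \<Inter>\<F>" by (rule InterI)
    then show ?thesis by force
  qed
  ultimately have "\<Inter>(insert (topspace Y) (\<phi> ` R)) \<noteq> {}"
    by (intro Y[unfolded compact_space_fip, rule_format]) auto
  then obtain y where "y \<in> topspace Y" "\<And>p. p \<in> R \<Longrightarrow> y \<in> \<phi> p" by blast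
  then show "\<exists>y\<in>topspace Y. matches R x y"
    by (auto simp: \<phi>_def matches_def intro!: bexI[of _ y])
qed

text \<open>A finite part of the union lies in a single member of the chain, and both
  \<open>covers\<close> conditions have finite character.\<close>

lemma partial_iso_Union_chain:
  assumes "compact_space X" "compact_space Y"
    and chain: "subset.chain {R. partial_iso X Y P f R} \<C>" "\<C> \<noteq> {}"
  shows "partial_iso X Y P f (\<Union>\<C>)"
proof -
  have iso: "partial_iso X Y P f R" if "R \<in> \<C>" for R
    using chain(1) that by (auto simp: subset_chain_def)
  have clop: "\<Union>\<C> \<subseteq> clopens X \<times> clopens Y"
    using iso by (fastforce simp: partial_iso_def)
  have finite_part: "covers X Y R' \<and> covers Y X (R'\<inverse>)" if R': "finite R'" "R' \<subseteq> \<Union>\<C>" for R'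
  proof -
    obtain R where "R \<in> \<C>" "R' \<subseteq> R"
      using finite_subset_Union_chain[OF R' chain(2,1)] .
    moreover from this have "R'\<inverse> \<subseteq> R\<inverse>" by blast
    moreover from calculation have "covers X Y R" "covers Y X (R\<inverse>)"
      using iso[of R] by (simp_all add: partial_iso_def)
    ultimately show ?thesis using covers_mono by metis
  qed
  have "covers X Y (\<Union>\<C>)"
    using covers_finite_character[OF assms(2) clop] finite_part by blast
  moreover have "covers Y X ((\<Union>\<C>)\<inverse>)"
  proof (rule covers_finite_character[OF assms(1)])
    show "(\<Union>\<C>)\<inverse> \<subseteq> clopens Y \<times> clopens X" using clop by auto
    fix R' assume "finite R'" "R' \<subseteq> (\<Union>\<C>)\<inverse>"
    then have "finite (R'\<inverse>)" "R'\<inverse> \<subseteq> \<Union>\<C>" by auto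
    then show "covers Y X R'" using finite_part[of "R'\<inverse>"] by simp
  qed
  moreover have "\<forall>x\<in>P. matches (\<Union>\<C>) x (f x)"
    using iso unfolding partial_iso_def matches_def by blast
  ultimately show ?thesis using clop by (simp add: partial_iso_def)
qed

text \<open>\<open>w'\<close> is the projection to \<open>Y\<close> of the closed set of matching
  pairs over \<open>w\<close>, and this projection is a closed map since \<open>X\<close> is
  compact. The complement of \<open>w\<close> yields the complement of \<open>w'\<close>, because
  \<open>w\<close> is saturated and every point of \<open>Y\<close> has a match; so
  \<open>w'\<close> is open too.\<close>

lemma transport_clopen:
  assumes X: "compact_space X" and R: "R \<subseteq> clopens X \<times> clopens Y" "covers Y X (R\<inverse>)"
    and w: "w \<in> clopens X" "\<And>x x'. x \<in> w \<Longrightarrow> x' \<in> topspace X \<Longrightarrow> same (Domain R) x x' \<Longrightarrow> x' \<in> w"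
  obtains w' where "w' \<in> clopens Y"
    "\<And>x y. x \<in> topspace X \<Longrightarrow> y \<in> topspace Y \<Longrightarrow> matches R x y \<Longrightarrow> y \<in> w' \<longleftrightarrow> x \<in> w"
proof -
  define T where "T = (\<lambda>w. {y \<in> topspace Y. \<exists>x\<in>w. matches R x y})"
  have iff: "y \<in> T w \<longleftrightarrow> x \<in> w" if "x \<in> topspace X" "y \<in> topspace Y" "matches R x y" for x y
  proof
    assume "y \<in> T w"
    then obtain x' where "x' \<in> w" "matches R x' y" by (auto simp: T_def)
    then show "x \<in> w" using w(2) same_Domain_if_matches that(1,3) by metis
  qed (use that in \<open>auto simp: T_def\<close>)
  have closed: "closedin Y (T v)" if v: "v \<in> clopens X" for v
  proof -
    \<comment> \<open>\<open>\<phi> p\<close> is the closed set of pairs of points that match with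
      respect to the single pair \<open>p\<close>.\<close>
    define \<phi> where "\<phi> = (\<lambda>(a, b). (a \<times> b) \<union> ((topspace X - a) \<times> (topspace Y - b)))"
    have "closedin (prod_topology X Y) (\<phi> p)" if "p \<in> R" for p
    proof -
      obtain a b where p: "p = (a, b)" "a \<in> clopens X" "b \<in> clopens Y" using R(1) \<open>p \<in> R\<close> by (cases p) auto
      then show ?thesis
        by (auto simp: \<phi>_def clopens_def intro!: closedin_Un closedin_prod_Times_iff[THEN iffD2])
    qed
    moreover have "closedin (prod_topology X Y) (v \<times> topspace Y)"
      using v by (auto simp: closedin_prod_Times_iff clopens_def)
    ultimately have "closedin (prod_topology X Y) (\<Inter>(insert (v \<times> topspace Y) (\<phi> ` R)))"
      by (intro closedin_Inter) auto
    moreover have "T v = snd ` \<Inter>(insert (v \<times> topspace Y) (\<phi> ` R))"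
    proof -
      have "(x, y) \<in> \<phi> (a, b) \<longleftrightarrow> (x \<in> a \<longleftrightarrow> y \<in> b)" if "x \<in> v" "y \<in> topspace Y" for x y a b
        using that clopens_subset[OF v] by (auto simp: \<phi>_def)
      then have "z \<in> \<Inter>(insert (v \<times> topspace Y) (\<phi> ` R)) \<longleftrightarrow>
          fst z \<in> v \<and> snd z \<in> topspace Y \<and> matches R (fst z) (snd z)" for z
        by (cases z) (auto simp: matches_def)
      then have "\<Inter>(insert (v \<times> topspace Y) (\<phi> ` R)) = {z. fst z \<in> v \<and> snd z \<in> topspace Y \<and> matches R (fst z) (snd z)}"
        by blast
      then show ?thesis by (force simp: T_def)
    qed
    ultimately show ?thesis
      using closed_map_snd[OF X, of Y] by (simp add: closed_map_def)
  qed
  have "topspace Y - T w = T (topspace X - w)"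
  proof (intro set_eqI iffI)
    fix y assume "y \<in> topspace Y - T w"
    moreover from this obtain x where "x \<in> topspace X" "matches R x y"
      using R(2) by (auto simp: covers_def matches_converse)
    ultimately show "y \<in> T (topspace X - w)" using iff[of x y] by (auto simp: T_def)
  next
    fix y assume "y \<in> T (topspace X - w)"
    then obtain x where "x \<in> topspace X" "x \<notin> w" "y \<in> topspace Y" "matches R x y"
      by (auto simp: T_def)
    then show "y \<in> topspace Y - T w" using iff by blast
  qed
  moreover have "T w \<subseteq> topspace Y" by (auto simp: T_def)
  ultimately have "T w \<in> clopens Y"
    using closed[OF w(1)] closed[OF clopens_Diff[OF clopens_topspace w(1)]]
    by (simp add: clopens_def openin_closedin_eq)
  then show thesis using iff that by blast
qed

section \<open>The symmetric setting and the one-step extension\<close>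

locale matching_spaces =
  fixes X :: "'a topology" and Y :: "'b topology" and P K f g
    and F :: "'a set \<Rightarrow> 'a set set" and G :: "'b set \<Rightarrow> 'b set set"
  assumes X: "compact_space X" "Hausdorff_space X" "zero_dimensional_space X"
    and Y: "compact_space Y" "Hausdorff_space Y" "zero_dimensional_space Y"
    and weight_infinite: "Cinfinite (weight X)" and weight_eq: "weight X =o weight Y"
    and points_X: "\<forall>x\<in>topspace X. negligible_in X {x}"
    and points_Y: "\<forall>y\<in>topspace Y. negligible_in Y {y}"
    and P: "closedin X P" "negligible_in X P"
    and K: "closedin Y K" "negligible_in Y K"
    and fg: "homeomorphic_maps (subtopology X P) (subtopology Y K) f g"
    and F: "supporting X F" and G: "supporting Y G"
begin

lemma weight_infinite_Y: "Cinfinite (weight Y)"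
  using Cinfinite_cong weight_eq weight_infinite by blast

text \<open>The hypotheses are symmetric, so every forth step yields a back step by passing to the
  converse relation.\<close>

lemma swap: "matching_spaces Y X K P g f G F"
  by (unfold_locales; fact X Y weight_infinite_Y ordIso_symmetric[OF weight_eq] points_X points_Y P K F G
      homeomorphic_maps_sym[THEN iffD1, OF fg])

lemma P_subset: "P \<subseteq> topspace X" and K_subset: "K \<subseteq> topspace Y"
  using P(1) K(1) by (simp_all add: closedin_subset)

lemma f_P: "x \<in> P \<Longrightarrow> f x \<in> K \<and> g (f x) = x" and g_K: "y \<in> K \<Longrightarrow> g y \<in> P \<and> f (g y) = y"
  using fg P_subset K_subset by (auto simp: homeomorphic_maps_def continuous_map_def Pi_iff Int_absorb1)

text \<open>\<open>tame\<close> is the invariant of single steps, since relative completeness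
  survives the insertion of one clopen set; \<open>support_closed\<close> is the invariant for
  limits, since it passes to unions of chains.\<close>

definition tame :: "('a set \<times> 'b set) set \<Rightarrow> bool" where
  "tame R \<longleftrightarrow> partial_iso X Y P f R \<and> |R| <o weight X \<and>
     rel_complete X (Domain R) \<and> rel_complete Y (Range R)"

definition support_closed :: "('a set \<times> 'b set) set \<Rightarrow> bool" where
  "support_closed R \<longleftrightarrow> partial_iso X Y P f R \<and> (\<forall>U\<in>Domain R. F U \<subseteq> Domain R) \<and> (\<forall>V\<in>Range R. G V \<subseteq> Range R)"

lemma partial_iso_converse:
  "partial_iso X Y P f R \<Longrightarrow> partial_iso Y X K g (R\<inverse>)"
proof -
  assume R: "partial_iso X Y P f R"
  have "matches R (g y) y" if "y \<in> K" for y
  proof -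
    have "\<forall>x\<in>P. matches R x (f x)" using R by (simp add: partial_iso_def)
    then have "matches R (g y) (f (g y))" using g_K[OF that] by blast
    then show ?thesis using g_K[OF that] by simp
  qed
  moreover have "R\<inverse> \<subseteq> clopens Y \<times> clopens X"
    using R unfolding partial_iso_def by blast
  ultimately show ?thesis
    using R by (simp add: partial_iso_def matches_converse)
qed

lemma support_closed_imp_tame:
  assumes "support_closed R" "|R| <o weight X"
  shows "tame R"
proof -
  have "R \<subseteq> clopens X \<times> clopens Y"
    using assms(1) by (simp add: support_closed_def partial_iso_def)
  then have "Domain R \<subseteq> clopens X" "Range R \<subseteq> clopens Y" by blast+
  then have "rel_complete X (Domain R)" "rel_complete Y (Range R)"
    using assms(1) F G by (simp_all add: supporting_def support_closed_def)
  then show ?thesis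
    using assms by (simp add: tame_def support_closed_def)
qed

text \<open>A fibre in \<open>Y\<close> has to meet \<open>b\<close> exactly when the corresponding
  fibre in \<open>X\<close> meets \<open>a\<close>, and likewise for the complements.
  \<open>A\<close> and \<open>A'\<close> consist of the points whose fibre meets \<open>a\<close>
  and its complement; \<open>B\<close> and \<open>B'\<close> are their counterparts in
  \<open>Y\<close>.\<close>

lemma tame_insert:
  assumes R: "tame R" and a: "a \<in> clopens X"
  obtains b where "tame (insert (a, b) R)"
proof -
  have iso: "R \<subseteq> clopens X \<times> clopens Y" "covers X Y R" "covers Y X (R\<inverse>)"
    and trace: "\<And>x. x \<in> P \<Longrightarrow> matches R x (f x)"
    and card: "|R| <o weight X"
    and rc: "rel_complete X (Domain R)" "rel_complete Y (Range R)"
    using R unfolding tame_def partial_iso_def by blast+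
  define A A' where "A = saturation X (Domain R) a"
    and "A' = saturation X (Domain R) (topspace X - a)"
  have AA': "A \<in> clopens X" "A' \<in> clopens X"
    using rc(1) a by (auto simp: A_def A'_def rel_complete_def clopens_Diff clopens_topspace)
  have satA: "x' \<in> A" if "x \<in> A" "x' \<in> topspace X" "same (Domain R) x x'" for x x'
    using that same_sym same_trans unfolding A_def saturation_def by fast
  have satA': "x' \<in> A'" if "x \<in> A'" "x' \<in> topspace X" "same (Domain R) x x'" for x x'
    using that same_sym same_trans unfolding A'_def saturation_def by fast
  have a_A: "x \<in> A" if "x \<in> a" for x
    using that clopens_subset[OF a] by (auto simp: A_def saturation_def intro: same_refl)
  have a_A': "x \<in> A'" if "x \<notin> a" "x \<in> topspace X" for x
    using that by (auto simp: A'_def saturation_def intro: same_refl)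
  obtain B where B: "B \<in> clopens Y" "\<And>x y. x \<in> topspace X \<Longrightarrow> y \<in> topspace Y \<Longrightarrow> matches R x y \<Longrightarrow> y \<in> B \<longleftrightarrow> x \<in> A"
    by (rule transport_clopen[OF X(1) iso(1,3) AA'(1)]) (use satA in blast)+
  obtain B' where B': "B' \<in> clopens Y" "\<And>x y. x \<in> topspace X \<Longrightarrow> y \<in> topspace Y \<Longrightarrow> matches R x y \<Longrightarrow> y \<in> B' \<longleftrightarrow> x \<in> A'"
    by (rule transport_clopen[OF X(1) iso(1,3) AA'(2)]) (use satA' in blast)+
  have "Range R \<subseteq> clopens Y" using iso(1) by auto
  moreover have "|Range R| <o weight Y"
  proof -
    have "|Range R| \<le>o |R|" unfolding Range_snd by (rule card_of_image)
    then show ?thesis using card weight_eq ordLeq_ordLess_trans ordLess_ordIso_trans by blast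
  qed
  ultimately obtain C D where CD: "C \<in> clopens Y" "D \<in> clopens Y" "C \<inter> D = {}" "C \<inter> K = {}" "D \<inter> K = {}"
    "\<forall>y\<in>topspace Y. (\<exists>z\<in>C. same (Range R) y z) \<and> (\<exists>z\<in>D. same (Range R) y z)"
    by (rule disjoint_transversal_clopens[OF Y weight_infinite_Y points_Y K _ _ rc(2)]) blast
  \<comment> \<open>\<open>k\<close> extends the copy of \<open>a \<inter> P\<close> in
    \<open>K\<close> to a clopen subset of \<open>Y\<close>.\<close>
  obtain k where k: "k \<in> clopens Y" "k \<inter> K = {y \<in> K. g y \<in> a}"
  proof -
    have "continuous_map (subtopology Y K) X g"
      using fg by (auto simp: homeomorphic_maps_def continuous_map_in_subtopology)
    moreover have "topspace (subtopology Y K) = K" using K_subset by auto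
    ultimately have "openin (subtopology Y K) {y \<in> K. g y \<in> a}" "closedin (subtopology Y K) {y \<in> K. g y \<in> a}"
      using a openin_continuous_map_preimage closedin_continuous_map_preimage
      unfolding clopens_def by fastforce+
    then show thesis
      using clopen_extension[OF Y(1,3) K(1)] that by (metis (mono_tags, lifting) clopens_def mem_Collect_eq)
  qed
  \<comment> \<open>\<open>B\<close> and the complement of \<open>B'\<close> are forced; on \<open>B \<inter> B'\<close>, where the fibres over \<open>Domain R\<close> meet both
    \<open>a\<close> and its complement, \<open>k\<close> prescribes the trace on \<open>K\<close> while \<open>C\<close> and \<open>D\<close> keep \<open>b\<close> and its complement
    meeting all fibres\<close>
  define b where "b = B \<inter> ((topspace Y - B') \<union> (k - D) \<union> C)"
  have b: "b \<in> clopens Y"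
    unfolding b_def using B(1) B'(1) CD(1,2) k(1)
    by (auto intro!: clopens_Int clopens_Un clopens_Diff clopens_topspace)
  have "covers X Y (insert (a, b) R)"
    unfolding covers_def
  proof
    fix x assume x: "x \<in> topspace X"
    then obtain y where y: "y \<in> topspace Y" "matches R x y" using iso(2) by (auto simp: covers_def)
    \<comment> \<open>\<open>y\<close> is replaced within its fibre by a point of \<open>C\<close>
      if \<open>x\<close> lies in \<open>a\<close>, and by a point of \<open>D\<close>
      otherwise.\<close>
    obtain c d where cd: "c \<in> C" "d \<in> D" "same (Range R) y c" "same (Range R) y d" using bspec[OF CD(6) y(1)] by blast
    then have m: "matches R x c" "matches R x d" using matches_same_Range[OF y(2)] by simp_all
    have t: "c \<in> topspace Y" "d \<in> topspace Y" using cd CD(1,2) clopens_subset by blast+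
    show "\<exists>y\<in>topspace Y. matches (insert (a, b) R) x y"
    proof (cases "x \<in> a")
      case True
      then have "c \<in> b" using B(2)[OF x t(1) m(1)] a_A cd(1) by (simp add: b_def)
      then show ?thesis using True t(1) m(1) by (auto simp: matches_insert)
    next
      case False
      then have "d \<notin> b" using B'(2)[OF x t(2) m(2)] a_A' x cd(2) CD(3) by (auto simp: b_def)
      then show ?thesis using False t(2) m(2) by (auto simp: matches_insert)
    qed
  qed
  moreover have "covers Y X ((insert (a, b) R)\<inverse>)"
    unfolding covers_def matches_converse
  proof
    fix y assume y: "y \<in> topspace Y"
    then obtain x where x: "x \<in> topspace X" "matches R x y"
      using iso(3) by (auto simp: covers_def matches_converse)
    have B_iff: "y \<in> B \<longleftrightarrow> x \<in> A" "y \<in> B' \<longleftrightarrow> x \<in> A'" using B(2) B'(2) x y by blast+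
    \<comment> \<open>Here \<open>y\<close> stays fixed and \<open>x\<close> moves within its fibre;
      \<open>A\<close> and \<open>A'\<close> tell on which sides of \<open>a\<close> that fibre has
      points.\<close>
    have "\<exists>x'\<in>topspace X. same (Domain R) x x' \<and> (x' \<in> a \<longleftrightarrow> y \<in> b)"
    proof (cases "y \<in> b")
      case True
      then have "x \<in> A" using B_iff by (simp add: b_def)
      then show ?thesis using True clopens_subset[OF a] by (auto simp: A_def saturation_def)
    next
      case False
      then have "x \<in> A'" using B_iff a_A a_A' x(1) y by (auto simp: b_def)
      then show ?thesis using False by (auto simp: A'_def saturation_def)
    qed
    then show "\<exists>x\<in>topspace X. matches (insert (a, b) R) x y"
      using matches_same_Domain[OF x(2)] by (metis matches_insert)
  qed
  moreover have "matches (insert (a, b) R) x (f x)" if "x \<in> P" for x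
  proof -
    have x: "x \<in> topspace X" "f x \<in> topspace Y" "f x \<in> K" "g (f x) = x"
      using f_P[OF that] subsetD[OF P_subset that] subsetD[OF K_subset] by simp_all
    have "f x \<in> k \<inter> K \<longleftrightarrow> f x \<in> {y \<in> K. g y \<in> a}" by (simp only: k(2))
    then have "f x \<in> k \<longleftrightarrow> x \<in> a" using x(3,4) by simp
    moreover have "f x \<in> B \<longleftrightarrow> x \<in> A" "f x \<in> B' \<longleftrightarrow> x \<in> A'"
      using B(2)[OF x(1,2) trace[OF that]] B'(2)[OF x(1,2) trace[OF that]] by simp_all
    moreover have "f x \<notin> C" "f x \<notin> D" using x(3) CD(4,5) by auto
    ultimately have "x \<in> a \<longleftrightarrow> f x \<in> b"
      using x(1,2) a_A a_A' by (auto simp: b_def)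
    then show ?thesis using trace[OF that] by (simp add: matches_insert)
  qed
  ultimately have "partial_iso X Y P f (insert (a, b) R)"
    using iso(1) a b by (simp add: partial_iso_def)
  moreover have "|insert (a, b) R| <o weight X"
  proof -
    have "|{(a, b)}| <o weight X"
      using weight_infinite by (simp add: finite_ordLess_Cinfinite)
    then show ?thesis using Un_Cinfinite_bound_strict[OF _ card weight_infinite] by fastforce
  qed
  ultimately have "tame (insert (a, b) R)"
    using rc a b by (simp add: tame_def rel_complete_insert)
  then show thesis using that by blast
qed

lemma tame_extend_Domain:
  assumes "finite E" "E \<subseteq> clopens X" "tame R"
  shows "\<exists>R'. R \<subseteq> R' \<and> finite (R' - R) \<and> tame R' \<and> E \<subseteq> Domain R'"
  using assms
proof (induction E rule: finite_induct)
  case empty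
  then show ?case by (intro exI[of _ R]) auto
next
  case (insert a E)
  then obtain R' where R': "R \<subseteq> R'" "finite (R' - R)" "tame R'" "E \<subseteq> Domain R'" by auto
  obtain b where "tame (insert (a, b) R')" using tame_insert[OF R'(3), of a] insert.prems by auto
  moreover have "finite (insert (a, b) R' - R)"
    using R'(2) by (auto simp: insert_Diff_if)
  ultimately show ?case using R' by (intro exI[of _ "insert (a, b) R'"]) auto
qed

end

lemma (in matching_spaces) tame_converse:
  assumes "tame R"
  shows "matching_spaces.tame Y X K g (R\<inverse>)"
proof -
  interpret sw: matching_spaces Y X K P g f G F by (rule swap)
  have "R\<inverse> = prod.swap ` R" by force
  then have "|R\<inverse>| \<le>o |R|" using card_of_image[of prod.swap R] by simp
  moreover have R: "partial_iso X Y P f R" "|R| <o weight X" "rel_complete X (Domain R)" "rel_complete Y (Range R)"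
    using assms by (auto simp: tame_def)
  ultimately have "|R\<inverse>| <o weight Y"
    using weight_eq ordLeq_ordLess_trans ordLess_ordIso_trans by blast
  then show ?thesis
    using R by (simp add: sw.tame_def partial_iso_converse)
qed

text \<open>After the forth steps for \<open>E\<close>, the back steps for \<open>E'\<close> are
  forth steps of the swapped setting, applied to the converse.\<close>

lemma (in matching_spaces) tame_extend:
  assumes R: "tame R" and E: "finite E" "E \<subseteq> clopens X" and E': "finite E'" "E' \<subseteq> clopens Y"
  shows "\<exists>R'. tame R' \<and> R \<subseteq> R' \<and> finite (R' - R) \<and> E \<subseteq> Domain R' \<and> E' \<subseteq> Range R'"
proof -
  interpret sw: matching_spaces Y X K P g f G F by (rule swap)
  obtain S where S: "R \<subseteq> S" "finite (S - R)" "tame S" "E \<subseteq> Domain S"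
    using tame_extend_Domain[OF E R] by blast
  obtain T where T: "S\<inverse> \<subseteq> T" "finite (T - S\<inverse>)" "sw.tame T" "E' \<subseteq> Domain T"
    using sw.tame_extend_Domain[OF E' tame_converse[OF S(3)]] by blast
  have "S \<subseteq> T\<inverse>" using T(1) by (simp only: converse_subset_swap)
  moreover have "T\<inverse> - R \<subseteq> (T - S\<inverse>)\<inverse> \<union> (S - R)" by auto
  then have "finite (T\<inverse> - R)" by (rule finite_subset) (use S(2) T(2) in simp)
  moreover have "E \<subseteq> Domain (T\<inverse>)" using S(4) Domain_mono[OF \<open>S \<subseteq> T\<inverse>\<close>] by (rule subset_trans)
  moreover have "E' \<subseteq> Range (T\<inverse>)" using T(4) by simp
  ultimately show ?thesis
    using S(1) sw.tame_converse[OF T(3)] by blast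
qed

section \<open>Closing off under supports\<close>

context matching_spaces
begin

lemma support_closed_Union_chain:
  assumes "\<And>R. R \<in> \<C> \<Longrightarrow> support_closed R" "\<And>R S. R \<in> \<C> \<Longrightarrow> S \<in> \<C> \<Longrightarrow> R \<subseteq> S \<or> S \<subseteq> R" "\<C> \<noteq> {}"
  shows "support_closed (\<Union>\<C>)"
proof -
  have "subset.chain {R. partial_iso X Y P f R} \<C>"
    using assms(1,2) by (simp add: subset_chain_def support_closed_def subset_iff)
  then have "partial_iso X Y P f (\<Union>\<C>)"
    using partial_iso_Union_chain[OF X(1) Y(1) _ assms(3)] by blast
  moreover have "F U \<subseteq> Domain (\<Union>\<C>)" if "U \<in> Domain (\<Union>\<C>)" for U
  proof -
    obtain R where "R \<in> \<C>" "U \<in> Domain R" using \<open>U \<in> Domain (\<Union>\<C>)\<close> unfolding Domain_Union by blast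
    moreover from this have "F U \<subseteq> Domain R" using assms(1) by (simp add: support_closed_def)
    ultimately show ?thesis unfolding Domain_Union by blast
  qed
  moreover have "G V \<subseteq> Range (\<Union>\<C>)" if "V \<in> Range (\<Union>\<C>)" for V
  proof -
    obtain R where "R \<in> \<C>" "V \<in> Range R" using \<open>V \<in> Range (\<Union>\<C>)\<close> unfolding Range_Union by blast
    moreover from this have "G V \<subseteq> Range R" using assms(1) by (simp add: support_closed_def)
    ultimately show ?thesis unfolding Range_Union by blast
  qed
  ultimately show ?thesis by (simp add: support_closed_def)
qed

text \<open>Stage \<open>n\<close> makes a finite extension that takes in \<open>a n\<close>,
  \<open>b n\<close> and the supports of everything added before, so the union is closed under
  supports. The stages themselves are only known to be tame, which is enough for extending
  them.\<close>

lemma support_closed_countable_extension: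
  fixes a :: "nat \<Rightarrow> 'a set" and b :: "nat \<Rightarrow> 'b set"
  assumes R: "support_closed R" "|R| <o weight X"
    and a: "range a \<subseteq> clopens X" and b: "range b \<subseteq> clopens Y"
  obtains R' where "support_closed R'" "R \<subseteq> R'" "countable (R' - R)" "range a \<subseteq> Domain R'" "range b \<subseteq> Range R'"
proof -
  define I where "I = (\<lambda>S. tame S \<and> R \<subseteq> S \<and> finite (S - R))"
  \<comment> \<open>only the supports of elements outside \<open>R\<close> are added, so that each step is finite\<close>
  define J where "J = (\<lambda>n S S'. S \<subseteq> S' \<and> insert (a n) (\<Union>U\<in>Domain (S - R). F U) \<subseteq> Domain S' \<and>
    insert (b n) (\<Union>V\<in>Range (S - R). G V) \<subseteq> Range S')"
  have "\<exists>S'. I S' \<and> J n S S'" if S: "I S" for S n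
  proof -
    have "S \<subseteq> clopens X \<times> clopens Y" using S by (simp add: I_def tame_def partial_iso_def)
    then have clop: "Domain (S - R) \<subseteq> clopens X" "Range (S - R) \<subseteq> clopens Y" by blast+
    have fin: "finite (Domain (S - R))" "finite (Range (S - R))"
      using S by (simp_all add: I_def finite_Domain finite_Range)
    have FU: "finite (F U)" "F U \<subseteq> clopens X" if "U \<in> Domain (S - R)" for U
      using F subsetD[OF clop(1) that] by (simp_all add: supporting_def)
    have GV: "finite (G V)" "G V \<subseteq> clopens Y" if "V \<in> Range (S - R)" for V
      using G subsetD[OF clop(2) that] by (simp_all add: supporting_def)
    have "finite (insert (a n) (\<Union>U\<in>Domain (S - R). F U))"
      "finite (insert (b n) (\<Union>V\<in>Range (S - R). G V))"
      using fin FU(1) GV(1) by blast+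
    moreover have "insert (a n) (\<Union>U\<in>Domain (S - R). F U) \<subseteq> clopens X"
      using FU(2) a by blast
    moreover have "insert (b n) (\<Union>V\<in>Range (S - R). G V) \<subseteq> clopens Y"
      using GV(2) b by blast
    ultimately obtain S' where S': "tame S'" "S \<subseteq> S'" "finite (S' - S)"
      "insert (a n) (\<Union>U\<in>Domain (S - R). F U) \<subseteq> Domain S'"
      "insert (b n) (\<Union>V\<in>Range (S - R). G V) \<subseteq> Range S'"
      using tame_extend[of S] S unfolding I_def by metis
    have "S' - R \<subseteq> (S' - S) \<union> (S - R)" by blast
    then have "finite (S' - R)" by (rule finite_subset) (use S S'(3) in \<open>simp add: I_def\<close>)
    then have "I S'" using S S'(1,2) unfolding I_def by blast
    moreover have "J n S S'" using S'(2,4,5) by (simp add: J_def)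
    ultimately show ?thesis by blast
  qed
  moreover have "I R" using support_closed_imp_tame[OF R] by (simp add: I_def)
  ultimately obtain s where s: "\<And>n. I (s n)" "\<And>n. J n (s n) (s (Suc n))"
    using dependent_nat_choice[of "\<lambda>_. I" J] by metis
  have mono: "s m \<subseteq> s n" if "m \<le> n" for m n
  proof (rule lift_Suc_mono_le[OF _ that])
    show "s k \<subseteq> s (Suc k)" for k using s(2)[of k] unfolding J_def by blast
  qed
  define R' where "R' = (\<Union>n. s n)"
  have R_R': "R \<subseteq> R'" using s(1)[of 0] by (auto simp: I_def R'_def)
  have Domain_step: "insert (a n) (\<Union>U\<in>Domain (s n - R). F U) \<subseteq> Domain R'" for n
  proof -
    have "Domain (s (Suc n)) \<subseteq> Domain R'" by (auto simp: R'_def)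
    then show ?thesis using s(2)[of n] unfolding J_def by (meson order_trans)
  qed
  have Range_step: "insert (b n) (\<Union>V\<in>Range (s n - R). G V) \<subseteq> Range R'" for n
  proof -
    have "Range (s (Suc n)) \<subseteq> Range R'" by (auto simp: R'_def)
    then show ?thesis using s(2)[of n] unfolding J_def by (meson order_trans)
  qed
  have "subset.chain {R. partial_iso X Y P f R} (range s)"
    unfolding subset_chain_def
  proof (intro conjI ballI)
    show "range s \<subseteq> {R. partial_iso X Y P f R}" using s(1) by (auto simp: I_def tame_def)
    fix A B assume "A \<in> range s" "B \<in> range s"
    then obtain m n where "A = s m" "B = s n" by blast
    then show "A \<subseteq> B \<or> B \<subseteq> A" using mono nat_le_linear[of m n] by blast
  qed
  then have "partial_iso X Y P f R'"
    unfolding R'_def by (rule partial_iso_Union_chain[OF X(1) Y(1)]) simp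
  moreover have "F U \<subseteq> Domain R'" if "U \<in> Domain R'" for U
  proof (cases "U \<in> Domain R")
    case True
    then have "F U \<subseteq> Domain R" using R(1) by (simp add: support_closed_def)
    then show ?thesis using Domain_mono[OF R_R'] by (rule subset_trans)
  next
    case False
    then obtain n where "U \<in> Domain (s n - R)" using \<open>U \<in> Domain R'\<close> by (auto simp: R'_def)
    then show ?thesis using Domain_step[of n] by blast
  qed
  moreover have "G V \<subseteq> Range R'" if "V \<in> Range R'" for V
  proof (cases "V \<in> Range R")
    case True
    then have "G V \<subseteq> Range R" using R(1) by (simp add: support_closed_def)
    then show ?thesis using Range_mono[OF R_R'] by (rule subset_trans)
  next
    case False
    then obtain n where "V \<in> Range (s n - R)" using \<open>V \<in> Range R'\<close> by (auto simp: R'_def)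
    then show ?thesis using Range_step[of n] by blast
  qed
  ultimately have "support_closed R'" by (simp add: support_closed_def)
  moreover have "R' - R = (\<Union>n. s n - R)" by (auto simp: R'_def)
  moreover have "countable (\<Union>n. s n - R)"
    using s(1) by (intro countable_UN) (simp_all add: I_def countable_finite)
  moreover have "range a \<subseteq> Domain R'" "range b \<subseteq> Range R'"
    using Domain_step Range_step by blast+
  ultimately show thesis using R_R' that[of R'] by simp
qed

end

subsection \<open>Weight\<close>

text \<open>A clopen set is compact, hence a finite union of members of a base, and an infinite base
  has only as many finite subfamilies as members.\<close>

lemma card_of_clopens:
  assumes X: "compact_space X" and inf: "Cinfinite (weight X)"
  shows "|clopens X| \<le>o weight X"
proof -
  obtain \<B> where \<B>: "is_base X \<B>" "weight X = |\<B>|" by (rule weight_least)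
  \<comment> \<open>\<open>E n\<close> consists of the unions of \<open>n\<close> members of
    \<open>\<B>\<close>, repetitions allowed.\<close>
  define E where "E = rec_nat {{}} (\<lambda>_ \<U>. (\<lambda>(B, U). B \<union> U) ` (\<B> \<times> \<U>))"
  have E: "E 0 = {{}}" "E (Suc n) = (\<lambda>(B, U). B \<union> U) ` (\<B> \<times> E n)" for n
    by (simp_all add: E_def)
  have "infinite \<B>"
    using inf by (simp add: \<B>(2) cinfinite_def Field_card_of)
  have "|E n| \<le>o |\<B>|" for n
  proof (induction n)
    case 0
    have "|{{} :: 'a set}| <o |\<B>|"
      using inf by (simp add: finite_ordLess_Cinfinite \<B>(2))
    then show ?case by (simp add: E(1) ordLess_imp_ordLeq)
  next
    case (Suc n)
    then have "|\<B> \<times> E n| \<le>o |\<B>|"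
      using \<open>infinite \<B>\<close> by (intro card_of_Times_ordLeq_infinite_Field) (simp_all add: Field_card_of card_of_card_order_on card_of_mono1)
    then show ?case
      unfolding E(2) using card_of_image ordLeq_transitive by blast
  qed
  moreover have "|UNIV :: nat set| \<le>o |\<B>|"
    using \<open>infinite \<B>\<close> by (simp add: infinite_iff_card_of_nat)
  ultimately have "|\<Union>n. E n| \<le>o |\<B>|"
    using inf UNION_Cinfinite_bound[of UNIV "|\<B>|" E] by (simp add: \<B>(2))
  moreover have "clopens X \<subseteq> (\<Union>n. E n)"
  proof
    fix U assume U: "U \<in> clopens X"
    have fin: "\<exists>n. \<Union>\<F> \<in> E n" if "finite \<F>" "\<F> \<subseteq> \<B>" for \<F>
      using that
    proof (induction \<F> rule: finite_induct)
      case empty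
      then show ?case using E(1) by auto
    next
      case (insert B \<F>)
      then obtain n where "\<Union>\<F> \<in> E n" by auto
      then have "\<Union>(insert B \<F>) \<in> E (Suc n)" 
        using insert.prems unfolding E(2) by (intro image_eqI[of _ _ "(B, \<Union>\<F>)"]) simp_all
      then show ?case by blast
    qed
    have "compactin X U" using X U closedin_compact_space by (auto simp: clopens_def)
    moreover have "\<forall>B\<in>{B \<in> \<B>. B \<subseteq> U}. openin X B" using \<B>(1) by (simp add: is_base_def)
    moreover have "U \<subseteq> \<Union>{B \<in> \<B>. B \<subseteq> U}"
      using \<B>(1) U unfolding is_base_def clopens_def by blast
    ultimately obtain \<F> where "finite \<F>" "\<F> \<subseteq> {B \<in> \<B>. B \<subseteq> U}" "U \<subseteq> \<Union>\<F>"
      unfolding compactin_def by meson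
    then have "U = \<Union>\<F>" "\<exists>n. \<Union>\<F> \<in> E n" using fin[of \<F>] by auto
    then show "U \<in> (\<Union>n. E n)" by auto
  qed
  ultimately show ?thesis
    unfolding \<B>(2) using card_of_mono1 ordLeq_transitive by blast
qed

text \<open>If a least base were finite, \<open>{x}\<close> would be the intersection of a proper,
  hence smaller, subfamily: the members containing \<open>x\<close> omit one that separates another
  point from \<open>x\<close>. In a one-point space the empty family serves.\<close>

lemma Cinfinite_weight:
  assumes X: "Hausdorff_space X" "topspace X \<noteq> {}" and pts: "\<forall>x\<in>topspace X. negligible_in X {x}"
  shows "Cinfinite (weight X)"
proof -
  obtain \<B> where \<B>: "is_base X \<B>" "weight X = |\<B>|" by (rule weight_least)
  obtain x where x: "x \<in> topspace X" using X(2) by blast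
  have base: "\<exists>B\<in>\<B>. y \<in> B \<and> B \<subseteq> U" if "openin X U" "y \<in> U" for U y
    using \<B>(1) that unfolding is_base_def by blast
  have "\<not> finite \<B>"
  proof
    assume fin: "finite \<B>"
    have "\<exists>\<U>\<subset>\<B>. x \<in> topspace X \<inter> \<Inter>\<U> \<and> topspace X \<inter> \<Inter>\<U> \<subseteq> {x}"
    proof (cases "topspace X = {x}")
      case True
      have "{} \<subset> \<B>" using base[OF openin_topspace x] by blast
      then show ?thesis using True by (intro exI[of _ "{}"]) simp
    next
      case False
      then obtain y where y: "y \<in> topspace X" "y \<noteq> x" using x by blast
      have sep: "\<exists>B\<in>\<B>. u \<in> B \<and> v \<notin> B" if uv: "u \<in> topspace X" "v \<in> topspace X" "u \<noteq> v" for u v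
      proof -
        obtain U where "openin X U" "u \<in> U" "v \<notin> U"
          using X(1) uv unfolding Hausdorff_space_def disjnt_iff by metis
        then show ?thesis using base by blast
      qed
      have "{B \<in> \<B>. x \<in> B} \<subset> \<B>" using sep[OF y(1) x y(2)] by blast
      moreover have "topspace X \<inter> \<Inter>{B \<in> \<B>. x \<in> B} \<subseteq> {x}" using sep[OF x] by blast
      ultimately show ?thesis using x by (intro exI[of _ "{B \<in> \<B>. x \<in> B}"]) simp
    qed
    then obtain \<U> where \<U>: "\<U> \<subset> \<B>" "x \<in> topspace X \<inter> \<Inter>\<U>" "topspace X \<inter> \<Inter>\<U> \<subseteq> {x}" by blast
    have "finite \<U>" using fin \<U>(1) finite_subset by blast
    then have "\<not> (\<exists>f. inj_on f \<B> \<and> f ` \<B> \<subseteq> \<U>)"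
      using psubset_card_mono[OF fin \<U>(1)] card_inj_on_le by (metis not_le)
    then have "|\<U>| <o weight X"
      unfolding \<B>(2) by (simp only: card_of_ordLess)
    moreover have "\<forall>U\<in>\<U>. openin X U" using \<U>(1) \<B>(1) by (auto simp: is_base_def)
    ultimately have "\<not> negligible_in X {x}"
      using \<U>(2,3) unfolding negligible_in_def by blast
    then show False using pts x by blast
  qed
  then show ?thesis
    by (simp add: \<B>(2) cinfinite_def Field_card_of card_of_card_order_on)
qed

text \<open>This carries emptiness across equality of weights; the free type \<open>'c\<close> lets
  spaces on different types be compared with one cardinal.\<close>

lemma weight_le_empty_iff: "weight (X :: 'a topology) \<le>o |{} :: 'c set| \<longleftrightarrow> topspace X = {}"
proof
  obtain \<B> where \<B>: "is_base X \<B>" "weight X = |\<B>|" by (rule weight_least)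
  assume "weight X \<le>o |{} :: 'c set|"
  then have "\<B> = {}" using card_of_empty3[of \<B>] \<B>(2) by simp
  then show "topspace X = {}" using \<B>(1) openin_topspace[of X] unfolding is_base_def by blast
next
  assume "topspace X = {}"
  then have "is_base X {}" using openin_subset[of X] unfolding is_base_def by blast
  then have "weight X \<le>o |{} :: 'a set set|" using weight_least[of X] by metis
  moreover have "|{} :: 'a set set| \<le>o |{} :: 'c set|" by (rule card_of_empty)
  ultimately show "weight X \<le>o |{} :: 'c set|" by (rule ordLeq_transitive)
qed

subsection \<open>Transfinite back-and-forth\<close>

context matching_spaces
begin

lemma support_closed_empty:
  assumes "topspace X \<noteq> {}" "topspace Y \<noteq> {}"
  shows "support_closed {}"
proof -
  have "\<exists>x. x \<in> topspace X" "\<exists>y. y \<in> topspace Y" using assms by blast+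
  then show ?thesis by (auto simp: support_closed_def partial_iso_def covers_def matches_def)
qed

text \<open>A single countable extension of the empty relation takes in enumerations of both clopen
  algebras.\<close>

lemma total_partial_iso_countable:
  assumes nonempty: "topspace X \<noteq> {}" "topspace Y \<noteq> {}"
    and "countable (clopens X)" "countable (clopens Y)"
  obtains R where "partial_iso X Y P f R" "Domain R = clopens X" "Range R = clopens Y"
proof -
  have ne: "clopens X \<noteq> {}" "clopens Y \<noteq> {}" using clopens_empty by blast+
  define a b where "a = from_nat_into (clopens X)" and "b = from_nat_into (clopens Y)"
  have ab: "range a = clopens X" "range b = clopens Y"
    using assms(3,4) ne by (simp_all add: a_def b_def range_from_nat_into)
  have "|{} :: ('a set \<times> 'b set) set| <o weight X"
    using weight_infinite by (simp add: finite_ordLess_Cinfinite)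
  then obtain R where R: "support_closed R" "{} \<subseteq> R" "countable (R - {})" "clopens X \<subseteq> Domain R" "clopens Y \<subseteq> Range R"
    by (rule support_closed_countable_extension[OF support_closed_empty[OF nonempty] _ eq_refl[OF ab(1)] eq_refl[OF ab(2)], unfolded ab])
  then have "partial_iso X Y P f R" by (simp add: support_closed_def)
  moreover from this have "R \<subseteq> clopens X \<times> clopens Y" by (simp add: partial_iso_def)
  then have "Domain R \<subseteq> clopens X" "Range R \<subseteq> clopens Y" by blast+
  ultimately show thesis using that R(4,5) by blast
qed

text \<open>In a recursion along the well-order \<open>r\<close> of the weight, stage
  \<open>x\<close> takes in \<open>a x\<close> and \<open>b x\<close> and adds countably many pairs
  to the union of the earlier stages. That union has at most as many pairs as
  \<open>underS r x\<close> and the naturals together have elements, fewer than the weight because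
  the weight is uncountable.\<close>

lemma total_partial_iso_uncountable:
  assumes nonempty: "topspace X \<noteq> {}" "topspace Y \<noteq> {}"
    and uncountable: "|UNIV :: nat set| <o weight X"
  obtains R where "partial_iso X Y P f R" "Domain R = clopens X" "Range R = clopens Y"
proof -
  define r where "r = weight X"
  have r: "Card_order r" "Well_order r" "\<not> finite (Field r)"
    using weight_infinite by (simp_all add: r_def cinfinite_def card_order_on_well_order_on)
  have field: "|Field r| =o r" using r(1) by (rule card_of_Field_ordIso)
  have ne: "clopens X \<noteq> {}" "clopens Y \<noteq> {}" using clopens_empty by blast+
  have "|clopens X| \<le>o |Field r|"
    using card_of_clopens[OF X(1) weight_infinite] ordIso_symmetric[OF field]
    unfolding r_def by (rule ordLeq_ordIso_trans)
  then obtain a where a: "a ` Field r = clopens X"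
    unfolding card_of_ordLeq2[OF ne(1), symmetric] by (rule exE)
  have "weight Y =o |Field r|"
    using ordIso_symmetric[OF weight_eq] ordIso_symmetric[OF field] unfolding r_def by (rule ordIso_transitive)
  with card_of_clopens[OF Y(1) weight_infinite_Y] have "|clopens Y| \<le>o |Field r|"
    by (rule ordLeq_ordIso_trans)
  then obtain b where b: "b ` Field r = clopens Y"
    unfolding card_of_ordLeq2[OF ne(2), symmetric] by (rule exE)
  have wf: "wf (r - Id)" using r(2) by (simp add: well_order_on_def)
  have trans: "z \<in> underS r x" if "z \<in> underS r y" "y \<in> underS r x" for x y z
  proof -
    have "trans r" "antisym r"
      using r(2) by (simp_all add: well_order_on_def linear_order_on_def partial_order_on_def preorder_on_def)
    then show ?thesis using that unfolding underS_def by (blast dest: transD antisymD)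
  qed
  have total: "y \<in> underS r z \<or> z \<in> underS r y" if "y \<in> Field r" "z \<in> Field r" "y \<noteq> z" for y z
    using that r(2) by (auto simp: underS_def well_order_on_def linear_order_on_def total_on_def)
  have underS_iff: "y \<in> underS r x \<longleftrightarrow> (y, x) \<in> r - Id" for x y
    by (auto simp: underS_def)
  \<comment> \<open>\<open>\<Psi> \<phi> x R\<close> says that \<open>R\<close> is admissible at
    stage \<open>x\<close> after the earlier stages of \<open>\<phi>\<close>. The recursion runs
    over the whole type, hence the guard \<open>x \<in> Field r\<close>.\<close>
  define \<Psi> where "\<Psi> = (\<lambda>\<phi> x R. support_closed R \<and> (\<Union>y\<in>underS r x. \<phi> y) \<subseteq> R \<and>
    countable (R - (\<Union>y\<in>underS r x. \<phi> y)) \<and>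
    (x \<in> Field r \<longrightarrow> a x \<in> Domain R \<and> b x \<in> Range R))"
  \<comment> \<open>This serves for initial segments in the recursion step and for all of
    \<open>Field r\<close> at the end.\<close>
  have chain: "support_closed (\<Union>y\<in>J. \<phi> y)"
    if J: "J \<subseteq> Field r" "\<And>y. y \<in> J \<Longrightarrow> \<Psi> \<phi> y (\<phi> y)" for J and \<phi> :: "'a set \<Rightarrow> ('a set \<times> 'b set) set"
  proof (cases "J = {}")
    case True
    then show ?thesis using support_closed_empty[OF nonempty] by simp
  next
    case False
    show ?thesis
    proof (rule support_closed_Union_chain)
      show "support_closed R" if "R \<in> \<phi> ` J" for R
        using that J(2) by (auto simp: \<Psi>_def)
      show "R \<subseteq> S \<or> S \<subseteq> R" if RS: "R \<in> \<phi> ` J" "S \<in> \<phi> ` J" for R S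
      proof -
        obtain y z where yz: "y \<in> J" "z \<in> J" "R = \<phi> y" "S = \<phi> z" using RS by blast
        have sub: "\<phi> u \<subseteq> \<phi> v" if "u \<in> underS r v" "v \<in> J" for u v
          using J(2)[OF that(2)] that(1) unfolding \<Psi>_def by blast
        show ?thesis
          using total[of y z] yz J(1) sub by blast
      qed
      show "\<phi> ` J \<noteq> {}" using False by simp
    qed
  qed
  have step: "\<exists>R. \<Psi> \<phi> x R" if prev: "\<And>y. (y, x) \<in> r - Id \<Longrightarrow> \<Psi> \<phi> y (\<phi> y)" for x \<phi>
  proof -
    define U where "U = (\<Union>y\<in>underS r x. \<phi> y)"
    have \<Psi>: "\<Psi> \<phi> y (\<phi> y)" if "y \<in> underS r x" for y
      using prev that underS_iff by blast
    have sat: "support_closed U"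
      unfolding U_def by (rule chain) (use \<Psi> underS_Field in auto)
    \<comment> \<open>\<open>U\<close> splits into countable increments, which bounds its cardinality also at singular stages\<close>
    have "U \<subseteq> (\<Union>y\<in>underS r x. \<phi> y - (\<Union>z\<in>underS r y. \<phi> z))"
    proof
      fix p assume "p \<in> U"
      then obtain y where "y \<in> {y \<in> underS r x. p \<in> \<phi> y}" by (auto simp: U_def)
      \<comment> \<open>\<open>p\<close> belongs to the increment of the first stage that contains
        it.\<close>
      from wf[unfolded wf_eq_minimal, rule_format, OF this]
      obtain m where m: "m \<in> underS r x" "p \<in> \<phi> m"
        and least: "\<forall>z. (z, m) \<in> r - Id \<longrightarrow> z \<notin> {y \<in> underS r x. p \<in> \<phi> y}" by blast
      have "p \<notin> \<phi> z" if z: "z \<in> underS r m" for z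
        using least trans[OF z m(1)] z unfolding underS_iff by blast
      with m show "p \<in> (\<Union>y\<in>underS r x. \<phi> y - (\<Union>z\<in>underS r y. \<phi> z))" by blast
    qed
    moreover have "|\<Union>y\<in>underS r x. \<phi> y - (\<Union>z\<in>underS r y. \<phi> z)| <o r"
    proof -
      \<comment> \<open>The copy of the naturals bounds the increments and keeps \<open>q\<close>
        infinite when \<open>underS r x\<close> is finite.\<close>
      define q where "q = |underS r x <+> (UNIV :: nat set)|"
      have q: "|underS r x| \<le>o q" "|UNIV :: nat set| \<le>o q"
        unfolding q_def by (rule card_of_Plus1, rule card_of_Plus2)
      have "Cinfinite q"
        unfolding q_def cinfinite_def by (simp add: Field_card_of card_of_card_order_on)
      moreover have "\<forall>y\<in>underS r x. |\<phi> y - (\<Union>z\<in>underS r y. \<phi> z)| \<le>o q"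
      proof
        fix y assume "y \<in> underS r x"
        then have "countable (\<phi> y - (\<Union>z\<in>underS r y. \<phi> z))" using \<Psi> by (simp add: \<Psi>_def)
        then have "|\<phi> y - (\<Union>z\<in>underS r y. \<phi> z)| \<le>o |UNIV :: nat set|"
          unfolding countable_def card_of_ordLeq[symmetric] by simp
        then show "|\<phi> y - (\<Union>z\<in>underS r y. \<phi> z)| \<le>o q" using q(2) by (rule ordLeq_transitive)
      qed
      ultimately have "|\<Union>y\<in>underS r x. \<phi> y - (\<Union>z\<in>underS r y. \<phi> z)| \<le>o q"
        by (intro UNION_Cinfinite_bound q(1))
      moreover have "|underS r x| <o r"
      proof (cases "x \<in> Field r")
        case True
        then show ?thesis using card_of_underS[OF r(1)] by blast
      next
        case False
        then have "underS r x = {}" by (auto simp: underS_def Field_def)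
        then show ?thesis using weight_infinite by (simp add: finite_ordLess_Cinfinite r_def)
      qed
      then have "q <o r"
        unfolding q_def using uncountable card_of_Plus_ordLess_infinite_Field[OF r(3,1)] by (simp add: r_def)
      ultimately show ?thesis by (rule ordLeq_ordLess_trans)
    qed
    ultimately have "|U| <o weight X"
      unfolding r_def using card_of_mono1 ordLeq_ordLess_trans by blast
    \<comment> \<open>Outside \<open>Field r\<close> nothing is prescribed, and the clopen set
      \<open>{}\<close> is a dummy.\<close>
    define a' b' where "a' = (if x \<in> Field r then a x else {})" and "b' = (if x \<in> Field r then b x else {})"
    have "a' \<in> clopens X" "b' \<in> clopens Y"
      using a b clopens_empty by (auto simp: a'_def b'_def)
    then have "range (\<lambda>_::nat. a') \<subseteq> clopens X" "range (\<lambda>_::nat. b') \<subseteq> clopens Y" by auto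
    from sat \<open>|U| <o weight X\<close> this
    obtain R where R: "support_closed R" "U \<subseteq> R" "countable (R - U)"
      "range (\<lambda>_::nat. a') \<subseteq> Domain R" "range (\<lambda>_::nat. b') \<subseteq> Range R"
      by (rule support_closed_countable_extension)
    have "a' \<in> Domain R" "b' \<in> Range R" using R(4,5) by (simp_all only: image_subset_iff UNIV_I ball_simps simp_thms)
    moreover have "a' = a x" "b' = b x" if "x \<in> Field r" using that by (simp_all add: a'_def b'_def)
    ultimately have "x \<in> Field r \<longrightarrow> a x \<in> Domain R \<and> b x \<in> Range R" by metis
    with R(1-3) have "\<Psi> \<phi> x R" unfolding \<Psi>_def U_def by blast
    then show ?thesis by blast
  qed
  have cong: "\<Psi> \<phi> x R = \<Psi> \<psi> x R" if "\<And>z. (z, x) \<in> r - Id \<Longrightarrow> \<phi> z = \<psi> z" for \<phi> \<psi> x R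
  proof -
    have "(\<Union>y\<in>underS r x. \<phi> y) = (\<Union>y\<in>underS r x. \<psi> y)"
      using that underS_iff by (intro SUP_cong) auto
    then show ?thesis by (simp add: \<Psi>_def)
  qed
  have "\<exists>\<phi>. \<forall>x. \<Psi> \<phi> x (\<phi> x)"
    by (rule dependent_wf_choice[OF wf]) (fact cong step)+
  then obtain \<phi> where \<phi>: "\<And>x. \<Psi> \<phi> x (\<phi> x)" by blast
  define R where "R = (\<Union>x\<in>Field r. \<phi> x)"
  have "support_closed R" unfolding R_def by (rule chain) (use \<phi> in auto)
  then have iso: "partial_iso X Y P f R" by (simp add: support_closed_def)
  then have "R \<subseteq> clopens X \<times> clopens Y" by (simp add: partial_iso_def)
  then have "Domain R \<subseteq> clopens X" "Range R \<subseteq> clopens Y" by blast+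
  moreover have "clopens X \<subseteq> Domain R" "clopens Y \<subseteq> Range R"
  proof -
    have ab: "a x \<in> Domain R" "b x \<in> Range R" if "x \<in> Field r" for x
    proof -
      have "\<phi> x \<subseteq> R" using that by (auto simp: R_def)
      note Domain_mono[OF this] Range_mono[OF this]
      moreover have "a x \<in> Domain (\<phi> x)" "b x \<in> Range (\<phi> x)"
        using \<phi>[of x] that unfolding \<Psi>_def by simp_all
      ultimately show "a x \<in> Domain R" "b x \<in> Range R" by blast+
    qed
    show "clopens X \<subseteq> Domain R" "clopens Y \<subseteq> Range R"
      using ab unfolding a[symmetric] b[symmetric] image_subset_iff by blast+
  qed
  ultimately show thesis using that iso by blast
qed

lemma total_partial_iso:
  assumes "topspace X \<noteq> {}" "topspace Y \<noteq> {}"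
  obtains R where "partial_iso X Y P f R" "Domain R = clopens X" "Range R = clopens Y"
proof (cases "|UNIV :: nat set| <o weight X")
  case True
  then show thesis using total_partial_iso_uncountable[OF assms] that by blast
next
  case False
  then have "weight X \<le>o |UNIV :: nat set|"
    using weight_infinite by (simp add: not_ordLess_iff_ordLeq card_order_on_well_order_on card_of_Well_order)
  then have "|clopens X| \<le>o |UNIV :: nat set|" "|clopens Y| \<le>o |UNIV :: nat set|"
    using card_of_clopens[OF X(1) weight_infinite] card_of_clopens[OF Y(1) weight_infinite_Y]
      ordIso_symmetric[OF weight_eq] ordLeq_transitive ordLeq_ordIso_trans by blast+
  then have "countable (clopens X)" "countable (clopens Y)"
    unfolding countable_def card_of_ordLeq[symmetric] by simp_all
  then show thesis using total_partial_iso_countable[OF assms] that by blast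
qed

text \<open>Clopen sets separate points, so with a total \<open>R\<close> each \<open>x\<close> has
  exactly one match \<open>h x\<close>, and on \<open>P\<close> this is \<open>f x\<close>. The
  preimage of a clopen set is its partner under \<open>R\<close>, so \<open>h\<close> is a
  continuous bijection from a compact to a Hausdorff space.\<close>

lemma homeomorphic_map_of_total_partial_iso:
  assumes R: "partial_iso X Y P f R" "Domain R = clopens X" "Range R = clopens Y"
  shows "\<exists>h. homeomorphic_map X Y h \<and> (\<forall>x\<in>P. h x = f x)"
proof -
  have "covers X Y R" using R(1) by (simp add: partial_iso_def)
  then obtain h where h: "\<And>x. x \<in> topspace X \<Longrightarrow> h x \<in> topspace Y \<and> matches R x (h x)"
    unfolding covers_def by metis
  have unique: "y = y'" if m: "matches R x y" "matches R x y'" and y: "y \<in> topspace Y" "y' \<in> topspace Y" for x y y'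
  proof (rule ccontr)
    assume "y \<noteq> y'"
    then obtain b where "b \<in> clopens Y" "y \<in> b" "y' \<notin> b"
      using separating_clopen[OF Y(3,2) y] by metis
    then show False using m R(3) unfolding matches_def by fast
  qed
  have "openin X {x \<in> topspace X. h x \<in> V}" if V: "openin Y V" for V
  proof (subst openin_subopen, intro ballI)
    fix x assume "x \<in> {x \<in> topspace X. h x \<in> V}"
    then have x: "x \<in> topspace X" "h x \<in> V" by auto
    obtain b where b: "b \<in> clopens Y" "h x \<in> b" "b \<subseteq> V"
      using zero_dimensional_clopen[OF Y(3) V x(2)] .
    then obtain a where a: "(a, b) \<in> R" using R(3) by blast
    then have "a \<in> clopens X" using R(2) by blast
    have iff: "z \<in> a \<longleftrightarrow> h z \<in> b" if "z \<in> topspace X" for z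
      using h[OF that] a unfolding matches_def by fast
    have "openin X a" "x \<in> a" "a \<subseteq> {x \<in> topspace X. h x \<in> V}"
      using \<open>a \<in> clopens X\<close> clopens_subset[OF \<open>a \<in> clopens X\<close>] iff x b by (auto simp: clopens_def)
    then show "\<exists>T. openin X T \<and> x \<in> T \<and> T \<subseteq> {x \<in> topspace X. h x \<in> V}" by blast
  qed
  then have cont: "continuous_map X Y h" using h by (auto simp: continuous_map_def)
  have inj: "inj_on h (topspace X)"
  proof (intro inj_onI, rule ccontr)
    fix x x' assume x: "x \<in> topspace X" "x' \<in> topspace X" "h x = h x'" "x \<noteq> x'"
    obtain a where "a \<in> clopens X" "x \<in> a" "x' \<notin> a"
      using separating_clopen[OF X(3,2) x(1,2,4)] .
    moreover from this obtain b where "(a, b) \<in> R" using R(2) by blast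
    ultimately have "h x \<in> b" "h x' \<notin> b"
      using h[OF x(1)] h[OF x(2)] unfolding matches_def by blast+
    then show False using x(3) by simp
  qed
  have surj: "h ` topspace X = topspace Y"
  proof (intro equalityI subsetI)
    fix y assume y: "y \<in> topspace Y"
    have "covers Y X (R\<inverse>)" using R(1) by (simp add: partial_iso_def)
    then obtain x where "x \<in> topspace X" "matches R x y"
      using y unfolding covers_def matches_converse by blast
    then show "y \<in> h ` topspace X" using unique[of x y "h x"] h[of x] y by blast
  qed (use h in blast)
  have "h x = f x" if x: "x \<in> P" for x
  proof -
    have "x \<in> topspace X" "f x \<in> topspace Y" using x f_P P_subset K_subset by blast+
    moreover have "matches R x (f x)" using R(1) x by (simp add: partial_iso_def)
    ultimately show ?thesis using unique[of x "h x" "f x"] h[of x] by blast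
  qed
  then show ?thesis
    using continuous_imp_homeomorphic_map[OF cont X(1) Y(2) surj inj] by blast
qed

end

theorem theorem1p1:
  fixes X :: "'a topology" and Y :: "'b topology"
    and P :: "'a set" and K :: "'b set" and f :: "'a \<Rightarrow> 'b"
  assumes "compact_space X" "Hausdorff_space X" "zero_dimensional_space X" "absolute_extensor_0 X"
    and "compact_space Y" "Hausdorff_space Y" "zero_dimensional_space Y" "absolute_extensor_0 Y"
    and "weight X =o weight Y"
    and "\<forall>x\<in>topspace X. negligible_in X {x}"
    and "\<forall>y\<in>topspace Y. negligible_in Y {y}"
    and "closedin X P" "negligible_in X P"
    and "closedin Y K" "negligible_in Y K"
    and "homeomorphic_map (subtopology X P) (subtopology Y K) f"
  shows "\<exists>F. homeomorphic_map X Y F \<and> (\<forall>x\<in>P. F x = f x)"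
proof (cases "topspace X = {} \<or> topspace Y = {}")
  case True
  \<comment> \<open>Empty spaces are treated apart because their weight is not infinite; if one
    space is empty, so is the other.\<close>
  have "weight Y \<le>o |{} :: 'a set| \<longleftrightarrow> weight X \<le>o |{} :: 'a set|"
    using ordIso_ordLeq_trans[OF assms(9)] ordIso_ordLeq_trans[OF ordIso_symmetric[OF assms(9)]] by blast
  then have "topspace X = {}" "topspace Y = {}"
    using True unfolding weight_le_empty_iff by blast+
  then have "homeomorphic_map X Y f"
    by (simp add: homeomorphic_map_def quotient_map_def)
  then show ?thesis by blast
next
  case False
  then have nonempty: "topspace X \<noteq> {}" "topspace Y \<noteq> {}" by auto
  obtain g where fg: "homeomorphic_maps (subtopology X P) (subtopology Y K) f g"
    using assms(16) by (auto simp: homeomorphic_map_maps)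
  obtain S T where ST: "supporting X S" "supporting Y T"
    using absolute_extensor_0_supporting[OF assms(1-4)] absolute_extensor_0_supporting[OF assms(5-8)] by blast
  interpret matching_spaces X Y P K f g S T
    by (unfold_locales; fact assms Cinfinite_weight[OF assms(2) nonempty(1) assms(10)] fg ST)
  show ?thesis
    by (rule total_partial_iso[OF nonempty]) (rule homeomorphic_map_of_total_partial_iso)
qed

end
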